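(* $\mathfrak{sp}\geq\mathrm{cov}(\mathcal{A})$.
   Context: A compactification $\alpha\omega$ of the countable discrete space $\omega$ is a compact Hausdorff space containing $\omega$ as a dense subspace. $\alpha\omega\leq\gamma\omega$ means there is a continuous surjection $f:\gamma\omega\to\alpha\omega$ whose restriction to $\omega$ is the identity; $\alpha\omega\simeq\gamma\omega$ means such an $f$ can be chosen to be a homeomorphism. Modulo $\simeq$, compactifications of $\omega$ ordered by $\leq$ form a complete upper semilattice with largest element the Stone–Čech compactification $\beta\omega$; $\sup$ is taken in it. $C_{\alpha\omega}$ denotes the set of bounded functions $\omega\to\mathbb{R}$ that extend continuously over $\alpha\omega$. Call a subring of the ring $C^*(\omega)$ of bounded (continuous) functions $\omega\to\mathbb{R}$ regular if it is closed in the uniform norm, contains all constants, and generates the topology of $\omega$; the map $\alpha\omega\mapsto C_{\alpha\omega}$ is an order isomorphism from compactifications (mod $\simeq$, with $\leq$) onto regular subrings (with $\subseteq$). $\mathrm{M}(\omega)$ is the set of all metrics on $\omega$ compatible with the discrete topology. For $d\in\mathrm{M}(\omega)$, the Smirnov compactification $u_d\omega$ is the compactification with $C_{u_d\omega}=U^*_d(\omega)$, the ring of all bounded uniformly continuous functions from $(\omega,d)$ to $\mathbb{R}$. $\mathrm{M}'(\omega)$ is the set of $d\in\mathrm{M}(\omega)$ with $\beta\omega\not\simeq u_d\omega$. A set $D\subseteq\mathrm{M}'(\omega)$ has the Smirnov finite intersection property (Smirnov-FIP) if for every finite $F\subseteq D$, $\beta\omega\not\simeq\sup\{u_d\omega: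 d\in F\}$. $\mathfrak{sp}$ is the smallest cardinality of a set $D\subseteq\mathrm{M}'(\omega)$ with the Smirnov-FIP such that $\beta\omega\simeq\sup\{u_d\omega: d\in D\}$. $(2^\omega,+)$ is the group under pointwise addition modulo 2 on the Cantor space $2^\omega$. $\mathcal{A}$ is the collection of proper subgroups of $(2^\omega,+)$ which are analytic subsets of $2^\omega$ and closed under finite modifications (if $f,g\in2^\omega$ agree at all but finitely many $n$, then $f$ belongs to the subgroup iff $g$ does). $\mathrm{cov}(\mathcal{A})$ is the smallest cardinality of a subfamily $\mathcal{A}'\subseteq\mathcal{A}$ with $\bigcup\mathcal{A}'=2^\omega$. Convention: if no set of the required kind exists, the cardinal being defined is $\infty$, and $\lambda<\infty$ for every cardinal $\lambda$. *)

theory Defs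
  imports "HOL-Analysis.Analysis" "HOL-Algebra.Group"
begin

unbundle cardinal_syntax

section \<open>Compactifications of the discrete space of natural numbers\<close>

text \<open>A compactification is given as a space together with the embedding of the natural
  numbers into it.\<close>

type_synonym 'a cpt = "'a topology \<times> (nat \<Rightarrow> 'a)"

definition compactification :: "'a cpt \<Rightarrow> bool" where
  "compactification X \<longleftrightarrow>
     compact_space (fst X) \<and> Hausdorff_space (fst X) \<and>
     embedding_map (discrete_topology UNIV) (fst X) (snd X) \<and>
     fst X closure_of range (snd X) = topspace (fst X)"

definition cpt_le :: "'a cpt \<Rightarrow> 'b cpt \<Rightarrow> bool" (infix "\<preceq>" 50) where
  "X \<preceq> Y \<longleftrightarrow>
     (\<exists>f. continuous_map (fst Y) (fst X) f \<and> f ` topspace (fst Y) = topspace (fst X) \<and>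
          (\<forall>n. f (snd Y n) = snd X n))"

definition cpt_equiv :: "'a cpt \<Rightarrow> 'b cpt \<Rightarrow> bool" (infix "\<simeq>" 50) where
  "X \<simeq> Y \<longleftrightarrow> (\<exists>f. homeomorphic_map (fst Y) (fst X) f \<and> (\<forall>n. f (snd Y n) = snd X n))"

definition C_cpt :: "'a cpt \<Rightarrow> (nat \<Rightarrow> real) set" where
  "C_cpt X = {f. bounded (range f) \<and>
     (\<exists>g. continuous_map (fst X) euclideanreal g \<and> (\<forall>n. g (snd X n) = f n))}"

text \<open>The points of compactifications are drawn from one fixed type. Writing \<open>\<cc>\<close> for the
  cardinality of the continuum, this type has cardinality \<open>2\<^sup>\<cc>\<close>, the cardinality of the
  Stone--Cech compactification, of which every compactification is a quotient. Hence every
  compactification is equivalent to one over this type, and the semilattice below is the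
  semilattice of all compactifications. (Concretely, a compactification can be realised as the
  closure of the image of the evaluation map \<open>n \<mapsto> (f \<mapsto> f n)\<close>.)\<close>

type_synonym point = "(nat \<Rightarrow> real) \<Rightarrow> real"

text \<open>The semilattice consists of equivalence classes modulo \<open>\<simeq>\<close>; the largest element,
  suprema and the Smirnov compactification are determined up to \<open>\<simeq>\<close>, and the following
  constants denote arbitrary representatives. They are only ever compared by \<open>\<simeq>\<close>.\<close>

definition beta_omega :: "point cpt" where
  "beta_omega = (SOME B. compactification B \<and>
     (\<forall>X :: point cpt. compactification X \<longrightarrow> X \<preceq> B))"

definition is_cpt_sup :: "point cpt set \<Rightarrow> point cpt \<Rightarrow> bool" where
  "is_cpt_sup \<X> Z \<longleftrightarrow> compactification Z \<and> (\<forall>X\<in>\<X>. X \<preceq> Z) \<and>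
     (\<forall>Y :: point cpt. compactification Y \<longrightarrow> (\<forall>X\<in>\<X>. X \<preceq> Y) \<longrightarrow> Z \<preceq> Y)"

text \<open>The supremum of the empty set is the least element, the one-point compactification.\<close>

definition cpt_sup :: "point cpt set \<Rightarrow> point cpt" where
  "cpt_sup \<X> = (SOME Z. is_cpt_sup \<X> Z)"

section \<open>Metrics, Smirnov compactifications and the Smirnov number\<close>

definition M_omega :: "(nat \<Rightarrow> nat \<Rightarrow> real) set" where
  "M_omega = {d. Metric_space UNIV d \<and> Metric_space.mtopology UNIV d = discrete_topology UNIV}"

definition U_star :: "(nat \<Rightarrow> nat \<Rightarrow> real) \<Rightarrow> (nat \<Rightarrow> real) set" where
  "U_star d = {f. bounded (range f) \<and>
     uniformly_continuous_map (metric (UNIV, d)) euclidean_metric f}"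

definition smirnov :: "(nat \<Rightarrow> nat \<Rightarrow> real) \<Rightarrow> point cpt" where
  "smirnov d = (SOME X. compactification X \<and> C_cpt X = U_star d)"

definition M'_omega :: "(nat \<Rightarrow> nat \<Rightarrow> real) set" where
  "M'_omega = {d \<in> M_omega. \<not> beta_omega \<simeq> smirnov d}"

definition smirnov_FIP :: "(nat \<Rightarrow> nat \<Rightarrow> real) set \<Rightarrow> bool" where
  "smirnov_FIP D \<longleftrightarrow> (\<forall>F\<subseteq>D. finite F \<longrightarrow> \<not> beta_omega \<simeq> cpt_sup (smirnov ` F))"

text \<open>Cardinals extended by \<open>\<infinity>\<close>, which is represented by \<open>None\<close>; it arises as the least
  cardinality over an empty family.\<close>

definition least_card :: "'a set set \<Rightarrow> 'a rel option" where
  "least_card \<S> =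
     (if \<S> = {} then None
      else Some (SOME \<kappa>. \<exists>X\<in>\<S>. \<kappa> = |X| \<and> (\<forall>Y\<in>\<S>. |X| \<le>o |Y| )))"

fun card_le :: "'a rel option \<Rightarrow> 'b rel option \<Rightarrow> bool" (infix "\<le>\<^sub>c" 50) where
  "\<kappa> \<le>\<^sub>c None \<longleftrightarrow> True"
| "None \<le>\<^sub>c Some \<mu> \<longleftrightarrow> False"
| "Some \<kappa> \<le>\<^sub>c Some \<mu> \<longleftrightarrow> \<kappa> \<le>o \<mu>"

definition sp :: "(nat \<Rightarrow> nat \<Rightarrow> real) rel option" where
  "sp = least_card {D. D \<subseteq> M'_omega \<and> smirnov_FIP D \<and> beta_omega \<simeq> cpt_sup (smirnov ` D)}"

section \<open>Analytic subgroups of the Cantor group\<close>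

definition cantor_group :: "(nat \<Rightarrow> bool) monoid" where
  "cantor_group = \<lparr>carrier = UNIV, monoid.mult = (\<lambda>f g n. f n \<noteq> g n), one = (\<lambda>n. False)\<rparr>"

definition cantor_space :: "(nat \<Rightarrow> bool) topology" where
  "cantor_space = product_topology (\<lambda>n. discrete_topology UNIV) UNIV"

definition baire_space :: "(nat \<Rightarrow> nat) topology" where
  "baire_space = product_topology (\<lambda>n. discrete_topology UNIV) UNIV"

definition analytic :: "(nat \<Rightarrow> bool) set \<Rightarrow> bool" where
  "analytic A \<longleftrightarrow> A = {} \<or> (\<exists>f. continuous_map baire_space cantor_space f \<and> range f = A)"

definition closed_fin_mod :: "(nat \<Rightarrow> bool) set \<Rightarrow> bool" where
  "closed_fin_mod A \<longleftrightarrow> (\<forall>f g. finite {n. f n \<noteq> g n} \<longrightarrow> (f \<in> A \<longleftrightarrow> g \<in> A))"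

definition A_family :: "(nat \<Rightarrow> bool) set set" where
  "A_family = {H. subgroup H cantor_group \<and> H \<noteq> UNIV \<and> analytic H \<and> closed_fin_mod H}"

definition cov_A :: "(nat \<Rightarrow> bool) set rel option" where
  "cov_A = least_card {\<A>. \<A> \<subseteq> A_family \<and> \<Union>\<A> = UNIV}"

end

theory Submission
  imports Defs "HOL-Algebra.Free_Abelian_Groups"
begin

text \<open>For a finite nonempty set \<open>F\<close> of metrics let \<open>H\<^sub>F\<close> be the set of all 0-1 sequences that extend
  continuously over the supremum of the \<open>u\<^sub>d\<omega>\<close>, \<open>d \<in> F\<close>. As \<open>x + y - 2xy\<close> is addition modulo 2, this is
  a subgroup; it is proper unless all bounded functions extend, since these are uniform limits of
  combinations of 0-1 sequences. A sequence \<open>x\<close> lies in \<open>H\<^sub>F\<close> iff there is a finite colouring of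
  \<open>\<omega>\<close> such that every colour class of \<open>{n. x n = 1}\<close> has positive distance from every colour
  class of \<open>{n. x n = 0}\<close> with respect to some \<open>d \<in> F\<close>; this makes \<open>H\<^sub>F\<close> a projection of a closed set. Only finitely
  many metrics occur in such a colouring, so if the supremum over \<open>D\<close> is the Stone--Cech
  compactification, then the \<open>H\<^sub>F\<close> with \<open>F \<subseteq> D\<close> finite cover the Cantor group, and there are
  \<open>|D|\<close> of them.\<close>

section \<open>Product topologies on function types\<close>

lemma open_vimage_coordinate: "open U \<Longrightarrow> open ((\<lambda>p :: 'a \<Rightarrow> 'b::topological_space. p x) -` U)"
  by (intro open_vimage continuous_on_product_coordinates)

text \<open>The library has these instances for countable domains only; declaring the strongest one
  first would clash with them.\<close>

instance "fun" :: (type, t0_space) t0_space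
proof
  fix f g :: "'a \<Rightarrow> 'b" assume "f \<noteq> g"
  then obtain x where x: "f x \<noteq> g x" by blast
  then obtain U where "open U" "\<not> (f x \<in> U \<longleftrightarrow> g x \<in> U)"
    using separation_t0[THEN iffD1, OF x] by blast
  then show "\<exists>U. open U \<and> \<not> (f \<in> U \<longleftrightarrow> g \<in> U)"
    by (intro exI[of _ "(\<lambda>p. p x) -` U"]) (simp add: open_vimage_coordinate)
qed

instance "fun" :: (type, t1_space) t1_space
proof
  fix f g :: "'a \<Rightarrow> 'b" assume "f \<noteq> g"
  then obtain x where x: "f x \<noteq> g x" by blast
  then obtain U where "open U" "f x \<in> U" "g x \<notin> U"
    using separation_t1[THEN iffD1, OF x] by blast
  then show "\<exists>U. open U \<and> f \<in> U \<and> g \<notin> U"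
    by (intro exI[of _ "(\<lambda>p. p x) -` U"]) (simp add: open_vimage_coordinate)
qed

text \<open>This makes \<open>point\<close> a Hausdorff type, so that compact sets of evaluations
  are closed.\<close>

instance "fun" :: (type, t2_space) t2_space
proof
  fix f g :: "'a \<Rightarrow> 'b" assume "f \<noteq> g"
  then obtain x where x: "f x \<noteq> g x" by blast
  then obtain U V where "open U" "open V" "f x \<in> U" "g x \<in> V" "U \<inter> V = {}"
    using separation_t2[THEN iffD1, OF x] by blast
  then show "\<exists>U V. open U \<and> open V \<and> f \<in> U \<and> g \<in> V \<and> U \<inter> V = {}"
    by (intro exI[of _ "(\<lambda>p. p x) -` U"] exI[of _ "(\<lambda>p. p x) -` V"])
      (auto simp: open_vimage_coordinate)
qed

section \<open>Regular subrings and compactifications\<close>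

text \<open>Within the discrete space of natural numbers, a uniformly closed subring containing the
  constants generates the topology iff it contains the indicators of all singletons.\<close>

locale regular_subring =
  fixes A :: "(nat \<Rightarrow> real) set"
  assumes bounded: "f \<in> A \<Longrightarrow> bounded (range f)"
    and const: "(\<lambda>_. c) \<in> A"
    and add: "f \<in> A \<Longrightarrow> g \<in> A \<Longrightarrow> (\<lambda>n. f n + g n) \<in> A"
    and mult: "f \<in> A \<Longrightarrow> g \<in> A \<Longrightarrow> (\<lambda>n. f n * g n) \<in> A"
    and indicator_singleton: "indicator {n} \<in> A"
    and uniform_limit: "(\<And>\<epsilon>. \<epsilon> > 0 \<Longrightarrow> \<exists>g\<in>A. \<forall>n. \<bar>f n - g n\<bar> \<le> \<epsilon>) \<Longrightarrow> f \<in> A"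
begin

lemma diff: "f \<in> A \<Longrightarrow> g \<in> A \<Longrightarrow> (\<lambda>n. f n - g n) \<in> A"
  using add[of f "\<lambda>n. -1 * g n"] mult[OF const[of "-1"], of g] by simp

lemma sum: "finite I \<Longrightarrow> (\<And>i. i \<in> I \<Longrightarrow> f i \<in> A) \<Longrightarrow> (\<lambda>n. \<Sum>i\<in>I. f i n) \<in> A"
  by (induction I rule: finite_induct) (simp_all add: add const)

lemma prod: "finite I \<Longrightarrow> (\<And>i. i \<in> I \<Longrightarrow> f i \<in> A) \<Longrightarrow> (\<lambda>n. \<Prod>i\<in>I. f i n) \<in> A"
  by (induction I rule: finite_induct) (simp_all add: mult const)

end

lemma regular_subring_bounded: "regular_subring {f. bounded (range f)}"
proof
  fix f g :: "nat \<Rightarrow> real"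
  assume "f \<in> {f. bounded (range f)}" "g \<in> {f. bounded (range f)}"
  then obtain B C where B: "\<And>n. \<bar>f n\<bar> \<le> B" and C: "\<And>n. \<bar>g n\<bar> \<le> C"
    by (auto simp: bounded_iff)
  have "\<bar>f n + g n\<bar> \<le> B + C" for n
    using B[of n] C[of n] by linarith
  then show "(\<lambda>n. f n + g n) \<in> {f. bounded (range f)}"
    by (auto simp: bounded_iff)
  have "\<bar>f n * g n\<bar> \<le> B * C" for n
    unfolding abs_mult using B[of n] C[of n] by (intro mult_mono) auto
  then show "(\<lambda>n. f n * g n) \<in> {f. bounded (range f)}"
    by (auto simp: bounded_iff)
next
  fix f :: "nat \<Rightarrow> real"
  assume "\<And>\<epsilon>. \<epsilon> > 0 \<Longrightarrow> \<exists>g\<in>{f. bounded (range f)}. \<forall>n. \<bar>f n - g n\<bar> \<le> \<epsilon>"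
  from this[of 1] obtain g B where g: "\<And>n. \<bar>f n - g n\<bar> \<le> 1" and B: "\<And>n. \<bar>g n\<bar> \<le> B"
    by (auto simp: bounded_iff)
  have "\<bar>f n\<bar> \<le> B + 1" for n
    using g[of n] B[of n] by linarith
  then show "f \<in> {f. bounded (range f)}"
    by (auto simp: bounded_iff)
next
  fix n :: nat
  show "(indicator {n} :: nat \<Rightarrow> real) \<in> {f. bounded (range f)}"
    by (auto simp: bounded_iff indicator_def intro!: exI[of _ 1])
qed auto

lemma regular_subring_Inter:
  assumes \<A>: "\<And>A. A \<in> \<A> \<Longrightarrow> regular_subring A" and "\<A> \<noteq> {}"
  shows "regular_subring (\<Inter>\<A>)"
proof
  obtain A where A: "A \<in> \<A>"
    using assms by blast
  show "bounded (range f)" if "f \<in> \<Inter>\<A>" for f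
    using regular_subring.bounded[OF \<A>[OF A]] that A by blast
  show "f \<in> \<Inter>\<A>" if lim: "\<And>\<epsilon>. \<epsilon> > 0 \<Longrightarrow> \<exists>g\<in>\<Inter>\<A>. \<forall>n. \<bar>f n - g n\<bar> \<le> \<epsilon>" for f
  proof
    fix A assume "A \<in> \<A>"
    show "f \<in> A"
    proof (rule regular_subring.uniform_limit)
      show "\<exists>g\<in>A. \<forall>n. \<bar>f n - g n\<bar> \<le> \<epsilon>" if "\<epsilon> > 0" for \<epsilon> :: real
        using lim[OF that] \<open>A \<in> \<A>\<close> by blast
    qed (rule \<A>[OF \<open>A \<in> \<A>\<close>])
  qed
qed (simp_all add: \<A> regular_subring.const regular_subring.add regular_subring.mult
    regular_subring.indicator_singleton)

section \<open>Realising a regular subring by a compactification\<close>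

text \<open>Coordinates outside \<open>A\<close> are frozen at 0, so that the evaluations for all
  \<open>A\<close> live in the one type \<open>point\<close>.\<close>

definition evaluation :: "(nat \<Rightarrow> real) set \<Rightarrow> nat \<Rightarrow> point" where
  "evaluation A n = (\<lambda>f. if f \<in> A then f n else 0)"

definition evaluation_cpt :: "(nat \<Rightarrow> real) set \<Rightarrow> point cpt" where
  "evaluation_cpt A = (top_of_set (closure (range (evaluation A))), evaluation A)"

text \<open>Tychonoff: each coordinate \<open>f\<close> of the range stays in a bounded interval, so
  the closure lies in a product of compact intervals.\<close>

lemma compact_closure_evaluation:
  assumes "\<And>f. f \<in> A \<Longrightarrow> bounded (range f)"
  shows "compact (closure (range (evaluation A)))"
proof -
  have "\<exists>b. \<forall>n. evaluation A n f \<in> {-b..b}" for f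
  proof (cases "f \<in> A")
    case True
    then obtain b where "\<And>n. \<bar>f n\<bar> \<le> b"
      using assms[of f] by (auto simp: bounded_iff)
    then have "\<And>n. - b \<le> f n \<and> f n \<le> b"
      by (simp add: abs_le_iff minus_le_iff)
    then show ?thesis
      by (auto simp: evaluation_def True)
  qed (auto simp: evaluation_def)
  then obtain b where b: "\<And>f n. evaluation A n f \<in> {-b f..b f}"
    by metis
  have "compact (Pi\<^sub>E UNIV (\<lambda>f. {-b f..b f}))"
    using compactin_PiE[where I=UNIV and X="\<lambda>_. euclideanreal" and S="\<lambda>f. {-b f..b f}"]
    by (simp add: euclidean_product_topology)
  moreover have "range (evaluation A) \<subseteq> Pi\<^sub>E UNIV (\<lambda>f. {-b f..b f})"
    using b by (auto simp: PiE_def)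
  ultimately show ?thesis
    using compact_Int_closed[OF _ closed_closure] closure_minimal[OF _ compact_imp_closed]
    by (metis inf.absorb2)
qed

lemma continuous_on_coordinate: "continuous_on S (\<lambda>p. p f)" for S :: "('a \<Rightarrow> 'b::topological_space) set"
  by (rule continuous_on_subset[OF continuous_on_product_coordinates]) auto

text \<open>The coordinate of the indicator of \<open>{n}\<close> singles out
  \<open>evaluation A n\<close>, so \<omega> is embedded injectively and as a discrete subspace;
  density holds by construction.\<close>

lemma (in regular_subring) compactification_evaluation_cpt: "compactification (evaluation_cpt A)"
proof -
  let ?e = "evaluation A" and ?S = "closure (range (evaluation A))"
  have apart: "?e m (indicator {n}) = (if m = n then 1 else 0)" for m n
    by (simp add: evaluation_def indicator_singleton indicator_def)
  have inj: "inj ?e"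
  proof (rule injI)
    fix m n assume "?e m = ?e n"
    then show "m = n"
      using apart[of m n] apart[of n n] by (auto split: if_splits)
  qed
  have "openin (top_of_set (range ?e)) {?e n}" for n
  proof -
    \<comment> \<open>On the range this coordinate takes only the values 0 and 1; 1/2 is a threshold
      between them.\<close>
    have "open ((\<lambda>p. p (indicator {n})) -` {1/2<..} :: point set)"
      using continuous_on_coordinate[of UNIV "indicator {n}"]
      by (intro open_vimage) auto
    moreover have "{?e n} = range ?e \<inter> (\<lambda>p. p (indicator {n})) -` {1/2<..}"
      using apart by (auto split: if_splits)
    ultimately show ?thesis
      by (metis openin_open_Int)
  qed
  then have disc: "top_of_set (range ?e) = discrete_topology (range ?e)"
    by (auto intro!: discrete_topology_unique[THEN iffD2, symmetric])
  have "embedding_map (discrete_topology UNIV) (top_of_set ?S) ?e"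
    unfolding embedding_map_def
  proof (rule bijective_open_imp_homeomorphic_map)
    have eq: "subtopology (top_of_set ?S) (?e ` topspace (discrete_topology UNIV)) = discrete_topology (range ?e)"
      by (metis disc closure_subset inf.absorb2 subtopology_subtopology topspace_discrete_topology)
    show "continuous_map (discrete_topology UNIV) (subtopology (top_of_set ?S) (?e ` topspace (discrete_topology UNIV))) ?e"
      unfolding eq by simp
    show "open_map (discrete_topology UNIV) (subtopology (top_of_set ?S) (?e ` topspace (discrete_topology UNIV))) ?e"
      unfolding eq by (auto simp: open_map_def)
    show "?e ` topspace (discrete_topology UNIV) = topspace (subtopology (top_of_set ?S) (?e ` topspace (discrete_topology UNIV)))"
      unfolding eq by simp
    show "inj_on ?e (topspace (discrete_topology UNIV))"
      using inj by simp
  qed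
  moreover have "top_of_set ?S closure_of range ?e = ?S"
    by (simp add: closure_of_subtopology closure_subset inf.absorb2)
  moreover have "compact_space (top_of_set ?S)"
    using compact_closure_evaluation[OF bounded] by (simp add: compact_space_subtopology)
  moreover have "Hausdorff_space (top_of_set ?S)"
    by (intro Hausdorff_space_subtopology) (simp add: Hausdorff_space_def disjnt_def, metis hausdorff)
  ultimately show ?thesis
    by (simp add: compactification_def evaluation_cpt_def)
qed

text \<open>Each \<open>f \<in> A\<close> extends as a coordinate projection. Conversely,
  Stone-Weierstrass approximates any continuous function uniformly by functions whose restriction to
  \<omega> lies in \<open>A\<close>, and \<open>A\<close> is uniformly closed.\<close>

lemma (in regular_subring) C_cpt_evaluation_cpt: "C_cpt (evaluation_cpt A) = A"
proof (intro equalityI subsetI)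
  fix f assume f: "f \<in> A"
  then have "f \<in> C_cpt (evaluation_cpt A) \<longleftrightarrow> (\<exists>g. continuous_on (closure (range (evaluation A))) g \<and> (\<forall>n. g (evaluation A n) = f n))"
    by (simp add: C_cpt_def evaluation_cpt_def bounded)
  also have "\<dots>"
    using f by (intro exI[of _ "\<lambda>p. p f"]) (auto simp: evaluation_def continuous_on_coordinate)
  finally show "f \<in> C_cpt (evaluation_cpt A)" .
next
  let ?e = "evaluation A" and ?S = "closure (range (evaluation A))"
  fix f assume "f \<in> C_cpt (evaluation_cpt A)"
  then obtain g where g: "continuous_on ?S g" "\<And>n. g (?e n) = f n"
    by (auto simp: C_cpt_def evaluation_cpt_def)
  define R where "R = {h. continuous_on ?S h \<and> (\<lambda>n. h (?e n)) \<in> A}"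
  interpret R: function_ring_on R ?S
  proof
    fix p q assume pq: "p \<in> ?S" "q \<in> ?S" "p \<noteq> q"
    then obtain f where f: "p f \<noteq> q f"
      by blast
    \<comment> \<open>Coordinate projections separate points, and each restricts on \<omega> to a
      member of \<open>A\<close> (to 0 when \<open>f \<notin> A\<close>).\<close>
    have "(\<lambda>n. ?e n f) \<in> A"
      by (cases "f \<in> A") (auto simp: evaluation_def const)
    then show "\<exists>h\<in>R. h p \<noteq> h q"
      using f by (intro bexI[of _ "\<lambda>p. p f"]) (auto simp: R_def continuous_on_coordinate)
  qed (auto simp: R_def compact_closure_evaluation bounded add mult const intro!: continuous_intros)
  show "f \<in> A"
  proof (rule uniform_limit)
    fix \<epsilon> :: real assume "\<epsilon> > 0"
    from R.Stone_Weierstrass_basic[OF g(1) this]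
    obtain h where h: "h \<in> R" "\<And>p. p \<in> ?S \<Longrightarrow> \<bar>g p - h p\<bar> < \<epsilon>"
      by blast
    have "\<bar>f n - h (?e n)\<bar> \<le> \<epsilon>" for n
      using h(2)[of "?e n"] closure_subset[of "range ?e"] g(2)[of n] by force
    then show "\<exists>g\<in>A. \<forall>n. \<bar>f n - g n\<bar> \<le> \<epsilon>"
      using h(1) by (intro bexI[of _ "\<lambda>n. h (?e n)"]) (auto simp: R_def)
  qed
qed

section \<open>The ring of functions extending over a compactification\<close>

text \<open>Density in the form used below: a closed condition that holds on \<omega> holds
  everywhere.\<close>

lemma compactification_dense:
  assumes "compactification X" "closedin (fst X) S" "range (snd X) \<subseteq> S"
  shows "topspace (fst X) \<subseteq> S"
  using assms closure_of_minimal unfolding compactification_def by metis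

lemma compactification_range:
  assumes "compactification X"
  shows "snd X n \<in> topspace (fst X)"
proof -
  have "homeomorphic_map (discrete_topology UNIV) (subtopology (fst X) (range (snd X))) (snd X)"
    using assms by (simp add: compactification_def embedding_map_def)
  from homeomorphic_imp_surjective_map[OF this]
  have "range (snd X) = topspace (fst X) \<inter> range (snd X)"
    by (simp only: topspace_subtopology topspace_discrete_topology)
  then show ?thesis
    by blast
qed

text \<open>A neighbourhood \<open>U\<close> of the point that meets \<omega> in that point alone
  contains nothing else, since \<open>U - {snd X n}\<close> is open and misses a dense set.\<close>

lemma openin_compactification_point:
  assumes X: "compactification X"
  shows "openin (fst X) {snd X n}"
proof -
  have "homeomorphic_map (discrete_topology UNIV) (subtopology (fst X) (range (snd X))) (snd X)"
    using X by (simp add: compactification_def embedding_map_def)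
  from homeomorphic_imp_open_map[OF this]
  have "openin (subtopology (fst X) (range (snd X))) (snd X ` {n})"
    unfolding open_map_def by (metis openin_discrete_topology subset_UNIV)
  then obtain U where U: "openin (fst X) U" "{snd X n} = U \<inter> range (snd X)"
    by (auto simp: openin_subtopology)
  have "closedin (fst X) {snd X n}"
    using X compactification_range[OF X] closedin_Hausdorff_sing_eq
    by (metis compactification_def)
  then have V: "openin (fst X) (U - {snd X n})"
    using U(1) by blast
  have "topspace (fst X) \<subseteq> topspace (fst X) - (U - {snd X n})"
    using V U(2) compactification_range[OF X]
    by (intro compactification_dense[OF X]) auto
  then have "U = {snd X n}"
    using U openin_subset[OF U(1)] by blast
  then show ?thesis
    using U(1) by simp
qed

lemma C_cptI:
  "bounded (range f) \<Longrightarrow> continuous_map (fst X) euclideanreal g \<Longrightarrow> (\<And>n. g (snd X n) = f n) \<Longrightarrow> f \<in> C_cpt X"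
  by (auto simp: C_cpt_def)

lemma C_cptE:
  assumes "f \<in> C_cpt X"
  obtains g where "bounded (range f)" "continuous_map (fst X) euclideanreal g" "\<And>n. g (snd X n) = f n"
  using assms unfolding C_cpt_def mem_Collect_eq by metis

lemma C_cpt_bounded: "f \<in> C_cpt X \<Longrightarrow> bounded (range f)"
  by (simp add: C_cpt_def)

text \<open>Sums and products of extensions are extensions, and indicators of singletons extend
  because the points of \<omega> are clopen. For a uniform limit, the extensions of the approximants
  form a uniformly Cauchy sequence whose limit is the extension sought.\<close>

lemma regular_subring_C_cpt:
  assumes X: "compactification X"
  shows "regular_subring (C_cpt X)"
proof
  interpret b: regular_subring "{f :: nat \<Rightarrow> real. bounded (range f)}"
    by (rule regular_subring_bounded)
  show "bounded (range f)" if "f \<in> C_cpt X" for f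
    using that by (auto simp: C_cpt_def)
  show "(\<lambda>_. c) \<in> C_cpt X" for c
    by (auto simp: C_cpt_def intro!: exI[of _ "\<lambda>_. c"])
  show "(\<lambda>n. f n + g n) \<in> C_cpt X" "(\<lambda>n. f n * g n) \<in> C_cpt X" if f: "f \<in> C_cpt X" and g: "g \<in> C_cpt X" for f g
  proof -
    obtain f' where f': "bounded (range f)" "continuous_map (fst X) euclideanreal f'" "\<And>n. f' (snd X n) = f n"
      using C_cptE[OF f] by metis
    obtain g' where g': "bounded (range g)" "continuous_map (fst X) euclideanreal g'" "\<And>n. g' (snd X n) = g n"
      using C_cptE[OF g] by metis
    have "bounded (range (\<lambda>n. f n + g n))" "bounded (range (\<lambda>n. f n * g n))"
      using b.add[of f g] b.mult[of f g] f'(1) g'(1) by simp_all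
    then show "(\<lambda>n. f n + g n) \<in> C_cpt X" "(\<lambda>n. f n * g n) \<in> C_cpt X"
      using continuous_map_add[OF f'(2) g'(2)] continuous_map_real_mult[OF f'(2) g'(2)] f'(3) g'(3)
      by (auto intro: C_cptI)
  qed
  show "indicator {n} \<in> C_cpt X" for n
  proof -
    have inj: "snd X m = snd X n \<longleftrightarrow> m = n" for m
      using X unfolding compactification_def embedding_map_def
      by (metis UNIV_I homeomorphic_imp_injective_map inj_on_eq_iff topspace_discrete_topology)
    have "openin (fst X) {x \<in> topspace (fst X). indicator {snd X n} x \<in> U}" for U :: "real set"
    proof -
      have "openin (fst X) (topspace (fst X) - {snd X n})"
        using X compactification_range[OF X] closedin_Hausdorff_sing_eq
        by (metis compactification_def openin_diff openin_topspace)
      moreover have "{x \<in> topspace (fst X). indicator {snd X n} x \<in> U} =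
          (if 1 \<in> U then {snd X n} else {}) \<union> (if 0 \<in> U then topspace (fst X) - {snd X n} else {})"
        using compactification_range[OF X] by (auto simp: indicator_def)
      ultimately show ?thesis
        using openin_compactification_point[OF X, of n] by (simp only:, intro openin_Un) auto
    qed
    then have "continuous_map (fst X) euclideanreal (indicator {snd X n})"
      by (simp add: continuous_map_def)
    moreover have "bounded (range (indicator {n} :: nat \<Rightarrow> real))"
      using b.indicator_singleton by blast
    ultimately show ?thesis
      using inj by (auto simp: C_cpt_def indicator_def)
  qed
  show "f \<in> C_cpt X" if lim: "\<And>\<epsilon>. \<epsilon> > 0 \<Longrightarrow> \<exists>g\<in>C_cpt X. \<forall>n. \<bar>f n - g n\<bar> \<le> \<epsilon>" for f
  proof -
    have "\<exists>g. continuous_map (fst X) euclideanreal g \<and> (\<forall>n. \<bar>f n - g (snd X n)\<bar> \<le> 1 / Suc k)" for k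
      using lim[of "1 / Suc k"] by (fastforce simp: C_cpt_def)
    then obtain g where cont: "\<And>k. continuous_map (fst X) euclideanreal (g k)"
      and g: "\<And>k n. \<bar>f n - g k (snd X n)\<bar> \<le> 1 / Suc k"
      by metis
    \<comment> \<open>Both approximants are close to \<open>f\<close> on \<omega>, hence to each
      other there; density carries the bound to the whole space.\<close>
    have close: "\<bar>g k x - g l x\<bar> \<le> 1 / Suc k + 1 / Suc l" if "x \<in> topspace (fst X)" for k l x
    proof -
      have "continuous_map (fst X) euclideanreal (\<lambda>x. \<bar>g k x - g l x\<bar>)"
        by (intro continuous_map_real_abs continuous_map_diff cont)
      then have "closedin (fst X) {x \<in> topspace (fst X). \<bar>g k x - g l x\<bar> \<in> {..1 / Suc k + 1 / Suc l}}"
        by (rule closedin_continuous_map_preimage) auto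
      moreover have "\<bar>g k (snd X n) - g l (snd X n)\<bar> \<le> 1 / Suc k + 1 / Suc l" for n
        using g[of n k] g[of n l] by linarith
      ultimately show ?thesis
        using compactification_dense[OF X] compactification_range[OF X] that by blast
    qed
    have Cauchy: "\<exists>N. \<forall>k l x. N \<le> k \<longrightarrow> N \<le> l \<longrightarrow> x \<in> topspace (fst X) \<longrightarrow> dist (g k x) (g l x) < \<epsilon>"
      if "\<epsilon> > 0" for \<epsilon>
    proof -
      obtain N where N: "1 / Suc N < \<epsilon> / 2"
        using nat_approx_posE[OF half_gt_zero] \<open>\<epsilon> > 0\<close> by metis
      show ?thesis
      proof (intro exI[of _ N] allI impI)
        fix k l x assume "N \<le> k" "N \<le> l" "x \<in> topspace (fst X)"
        moreover from this have "1 / Suc k \<le> 1 / Suc N" "1 / Suc l \<le> 1 / Suc N"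
          by (auto simp: field_simps)
        ultimately show "dist (g k x) (g l x) < \<epsilon>"
          using close[of x k l] N unfolding dist_real_def by linarith
      qed
    qed
    have "Met_TC.mcomplete TYPE(real)"
      using complete_UNIV by (simp add: mcomplete_iff_complete)
    then obtain h where h: "continuous_map (fst X) euclideanreal h"
      and lim_h: "\<And>\<epsilon>. 0 < \<epsilon> \<Longrightarrow> \<forall>\<^sub>F k in sequentially. \<forall>x\<in>topspace (fst X). dist (g k x) (h x) < \<epsilon>"
      using Met_TC.continuous_map_uniformly_Cauchy_limit[of "fst X" g] cont Cauchy
      by (auto simp: mtopology_is_euclidean)
    have "h (snd X n) = f n" for n
    proof (rule tendsto_unique)
      show "(\<lambda>k. g k (snd X n)) \<longlonglongrightarrow> h (snd X n)"
        using lim_h compactification_range[OF X] by (force simp: tendsto_iff elim: eventually_mono)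
      have "(\<lambda>k. f n - g k (snd X n)) \<longlonglongrightarrow> 0"
        by (rule tendsto_rabs_zero_cancel, rule tendsto_sandwich[OF _ _ tendsto_const LIMSEQ_inverse_real_of_nat])
          (use g in \<open>auto simp: inverse_eq_divide\<close>)
      from tendsto_diff[OF tendsto_const[of "f n"] this] show "(\<lambda>k. g k (snd X n)) \<longlonglongrightarrow> f n"
        by simp
    qed auto
    moreover have "bounded (range f)"
    proof -
      have "f \<in> {f. bounded (range f)}"
        by (rule b.uniform_limit) (use lim in \<open>fastforce simp: C_cpt_def\<close>)
      then show ?thesis by simp
    qed
    ultimately show ?thesis
      using h by (auto simp: C_cpt_def)
  qed
qed

section \<open>The order isomorphism between compactifications and regular subrings\<close>

lemma C_cpt_mono:
  assumes "X \<preceq> Y"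
  shows "C_cpt X \<subseteq> C_cpt Y"
proof
  fix f assume "f \<in> C_cpt X"
  then obtain g where g: "bounded (range f)" "continuous_map (fst X) euclideanreal g" "\<And>n. g (snd X n) = f n"
    by (auto simp: C_cpt_def)
  obtain h where h: "continuous_map (fst Y) (fst X) h" "\<And>n. h (snd Y n) = snd X n"
    using assms by (auto simp: cpt_le_def)
  show "f \<in> C_cpt Y"
    using g(1,3) h(2) continuous_map_compose[OF h(1) g(2)]
    by (auto simp: C_cpt_def intro!: exI[of _ "g \<circ> h"])
qed

lemma cpt_equiv_imp_le: "X \<simeq> Y \<Longrightarrow> X \<preceq> Y"
  unfolding cpt_equiv_def cpt_le_def
  by (metis homeomorphic_imp_continuous_map homeomorphic_imp_surjective_map)

lemma cpt_equiv_sym: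
  assumes "compactification Y" "X \<simeq> Y"
  shows "Y \<simeq> X"
proof -
  obtain f where f: "homeomorphic_map (fst Y) (fst X) f" "\<And>n. f (snd Y n) = snd X n"
    using assms(2) by (auto simp: cpt_equiv_def)
  obtain g where g: "homeomorphic_maps (fst Y) (fst X) f g"
    using f(1) homeomorphic_map_maps by blast
  then have "homeomorphic_map (fst X) (fst Y) g" "g (f (snd Y n)) = snd Y n" for n
    using compactification_range[OF assms(1)] by (auto simp: homeomorphic_maps_map)
  then show ?thesis
    using f(2) unfolding cpt_equiv_def by metis
qed

lemma cpt_equiv_trans:
  assumes "X \<simeq> Y" "Y \<simeq> Z"
  shows "X \<simeq> Z"
proof -
  obtain f g where "homeomorphic_map (fst Y) (fst X) f" "\<And>n. f (snd Y n) = snd X n"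
    and "homeomorphic_map (fst Z) (fst Y) g" "\<And>n. g (snd Z n) = snd Y n"
    using assms by (auto simp: cpt_equiv_def)
  then show ?thesis
    unfolding cpt_equiv_def by (intro exI[of _ "f \<circ> g"]) (auto intro: homeomorphic_map_compose)
qed

lemma cpt_le_trans:
  assumes "X \<preceq> Y" "Y \<preceq> Z"
  shows "X \<preceq> Z"
proof -
  obtain f g where "continuous_map (fst Y) (fst X) f" "f ` topspace (fst Y) = topspace (fst X)" "\<And>n. f (snd Y n) = snd X n"
    and "continuous_map (fst Z) (fst Y) g" "g ` topspace (fst Z) = topspace (fst Y)" "\<And>n. g (snd Z n) = snd Y n"
    using assms by (auto simp: cpt_le_def)
  then show ?thesis
    unfolding cpt_le_def by (intro exI[of _ "f \<circ> g"]) (metis comp_apply continuous_map_compose image_comp)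
qed

text \<open>A point \<open>x\<close> is sent to the values at \<open>x\<close> of all extended
  functions. The map is injective by Urysohn's lemma, its image is the closure of the evaluations by
  compactness and density, and a continuous bijection from a compact to a Hausdorff space is a
  homeomorphism.\<close>

lemma evaluation_cpt_equiv:
  assumes X: "compactification X"
  shows "evaluation_cpt (C_cpt X) \<simeq> X"
proof -
  let ?A = "C_cpt X"
  interpret regular_subring ?A
    using X by (rule regular_subring_C_cpt)
  let ?e = "evaluation ?A" and ?S = "closure (range (evaluation ?A))"
  have "\<exists>g. continuous_map (fst X) euclideanreal g \<and> (f \<in> ?A \<longrightarrow> (\<forall>n. g (snd X n) = f n))" for f
  proof (cases "f \<in> ?A")
    case True
    then show ?thesis
      using C_cptE[OF True] by metis
  next
    case False
    then show ?thesis
      by (intro exI[of _ "\<lambda>_. 0"]) simp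
  qed
  then obtain E where E: "\<And>f. continuous_map (fst X) euclideanreal (E f)" "\<And>f n. f \<in> ?A \<Longrightarrow> E f (snd X n) = f n"
    by metis
  define \<Phi> where "\<Phi> x = (\<lambda>f. if f \<in> ?A then E f x else 0)" for x
  have \<Phi>_snd: "\<Phi> (snd X n) = ?e n" for n
    using E(2) by (auto simp: \<Phi>_def evaluation_def)
  have "continuous_map (fst X) euclideanreal (\<lambda>x. \<Phi> x f)" for f
    using E(1) by (cases "f \<in> ?A") (auto simp: \<Phi>_def)
  then have cont: "continuous_map (fst X) euclidean \<Phi>"
    by (subst euclidean_product_topology[symmetric]) (simp add: continuous_map_componentwise_UNIV)
  \<comment> \<open>The chosen extension agrees with any given one, since they coincide on \<omega>;
    so the Urysohn function below can be read off from \<open>\<Phi>\<close>.\<close>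
  have E_unique: "E (\<lambda>n. g (snd X n)) x = g x"
    if g: "continuous_map (fst X) euclideanreal g" "bounded (range (\<lambda>n. g (snd X n)))" "x \<in> topspace (fst X)" for g x
  proof -
    let ?f = "\<lambda>n. g (snd X n)"
    have "?f \<in> ?A"
      using g by (auto simp: C_cpt_def)
    moreover have "closedin (fst X) {x \<in> topspace (fst X). E ?f x - g x \<in> {0}}"
      by (rule closedin_continuous_map_preimage) (auto intro: continuous_map_diff E g)
    ultimately show ?thesis
      using E(2)[of ?f] compactification_dense[OF X] compactification_range[OF X] g(3) by force
  qed
  have inj: "inj_on \<Phi> (topspace (fst X))"
  proof (rule inj_onI, rule ccontr)
    fix x y assume xy: "x \<in> topspace (fst X)" "y \<in> topspace (fst X)" "\<Phi> x = \<Phi> y" "x \<noteq> y"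
    have "normal_space (fst X)"
      using X compact_Hausdorff_or_regular_imp_normal_space by (auto simp: compactification_def)
    moreover have "closedin (fst X) {x}" "closedin (fst X) {y}"
      using X xy closedin_Hausdorff_sing_eq by (metis compactification_def)+
    ultimately obtain g where g: "continuous_map (fst X) (top_of_set {0..1::real}) g" "g ` {x} \<subseteq> {0}" "g ` {y} \<subseteq> {1}"
      using Urysohn_lemma[of "fst X" "{x}" "{y}" 0 1] xy(4) by (auto simp: disjnt_def)
    have gc: "continuous_map (fst X) euclideanreal g"
      using g(1) by (simp add: continuous_map_in_subtopology)
    have "g (snd X n) \<in> {0..1}" for n
      using g(1) compactification_range[OF X] by (auto simp: continuous_map_in_subtopology)
    then have gb: "bounded (range (\<lambda>n. g (snd X n)))"
      by (intro bounded_subset[OF bounded_closed_interval[of 0 1]]) auto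
    let ?f = "\<lambda>n. g (snd X n)"
    have "?f \<in> ?A"
      using gc gb by (auto simp: C_cpt_def)
    then have "E ?f x = E ?f y"
      using fun_cong[OF xy(3), of ?f] by (simp add: \<Phi>_def)
    then show False
      using g(2,3) E_unique[OF gc gb] xy by simp
  qed
  have "compact (\<Phi> ` topspace (fst X))"
    using image_compactin[OF _ cont, of "topspace (fst X)"] X
    by (auto simp: compactification_def compact_space_def)
  then have "?S \<subseteq> \<Phi> ` topspace (fst X)"
    using compactification_range[OF X]
    by (intro closure_minimal compact_imp_closed) (force simp flip: \<Phi>_snd)+
  moreover have "\<Phi> ` topspace (fst X) \<subseteq> ?S"
  proof -
    have "closedin (fst X) {x \<in> topspace (fst X). \<Phi> x \<in> ?S}"
      by (rule closedin_continuous_map_preimage[OF cont]) auto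
    moreover have "\<Phi> (snd X n) \<in> ?S" for n
      unfolding \<Phi>_snd by (rule closure_subset[THEN subsetD]) simp
    ultimately have "topspace (fst X) \<subseteq> {x \<in> topspace (fst X). \<Phi> x \<in> ?S}"
      using compactification_range[OF X] by (intro compactification_dense[OF X]) auto
    then show ?thesis
      by blast
  qed
  ultimately have img: "\<Phi> ` topspace (fst X) = ?S"
    by blast
  have cont': "continuous_map (fst X) (top_of_set ?S) \<Phi>"
    using cont img by (auto simp: continuous_map_in_subtopology)
  have K: "compactification (evaluation_cpt ?A)"
    by (rule compactification_evaluation_cpt)
  have "closed_map (fst X) (top_of_set ?S) \<Phi>"
    using X K cont' by (intro continuous_imp_closed_map_gen Hausdorff_imp_kc_space)
      (auto simp: compactification_def evaluation_cpt_def)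
  then have "homeomorphic_map (fst X) (top_of_set ?S) \<Phi>"
    using cont' inj img by (intro bijective_closed_imp_homeomorphic_map) auto
  then show ?thesis
    using \<Phi>_snd by (auto simp: cpt_equiv_def evaluation_cpt_def)
qed

text \<open>Forgetting the coordinates outside \<open>A\<close> is continuous. It is onto, because
  its image is compact, hence closed, and contains \<open>range (evaluation A)\<close>.\<close>

lemma evaluation_cpt_mono:
  assumes "A \<subseteq> B" "\<And>f. f \<in> B \<Longrightarrow> bounded (range f)"
  shows "evaluation_cpt A \<preceq> evaluation_cpt B"
proof -
  let ?S = "closure (range (evaluation A))" and ?T = "closure (range (evaluation B))"
  define \<rho> where "\<rho> p = (\<lambda>f. if f \<in> A then p f else 0)" for p :: point
  have \<rho>: "\<rho> (evaluation B n) = evaluation A n" for n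
    using assms(1) by (auto simp: \<rho>_def evaluation_def fun_eq_iff)
  have "continuous_on UNIV (\<lambda>p. \<rho> p f)" for f
    by (cases "f \<in> A") (auto simp: \<rho>_def continuous_on_coordinate)
  then have cont: "continuous_on T \<rho>" for T
    using continuous_on_coordinatewise_then_product continuous_on_subset by blast
  have "\<rho> ` ?T \<subseteq> closure (\<rho> ` range (evaluation B))"
    using continuous_image_closure_subset[OF cont[of UNIV]] by simp
  also have "\<rho> ` range (evaluation B) = range (evaluation A)"
    using \<rho> by (simp add: image_image)
  finally have sub: "\<rho> ` ?T \<subseteq> ?S" .
  have "compact (\<rho> ` ?T)"
    by (intro compact_continuous_image cont compact_closure_evaluation assms)
  then have "?S \<subseteq> \<rho> ` ?T"
    using closure_subset[of "range (evaluation B)"] \<rho>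
    by (intro closure_minimal compact_imp_closed) (force simp flip: \<rho>)+
  with sub have "\<rho> ` ?T = ?S"
    by blast
  with \<rho> cont show ?thesis
    by (auto simp: cpt_le_def evaluation_cpt_def intro!: exI[of _ \<rho>])
qed

text \<open>For the converse of \<open>C_cpt_mono\<close>, both spaces are replaced by evaluation
  compactifications, between which inclusion of rings gives a projection.\<close>

lemma cpt_le_iff:
  assumes "compactification X" "compactification Y"
  shows "X \<preceq> Y \<longleftrightarrow> C_cpt X \<subseteq> C_cpt Y"
proof
  assume "C_cpt X \<subseteq> C_cpt Y"
  then have "evaluation_cpt (C_cpt X) \<preceq> evaluation_cpt (C_cpt Y)"
    by (rule evaluation_cpt_mono) (auto simp: C_cpt_def)
  moreover have "X \<preceq> evaluation_cpt (C_cpt X)" "evaluation_cpt (C_cpt Y) \<preceq> Y"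
    by (simp_all add: assms cpt_equiv_imp_le cpt_equiv_sym evaluation_cpt_equiv)
  ultimately show "X \<preceq> Y"
    by (metis cpt_le_trans)
qed (rule C_cpt_mono)

lemma cpt_equiv_iff:
  assumes "compactification X" "compactification Y"
  shows "X \<simeq> Y \<longleftrightarrow> C_cpt X = C_cpt Y"
proof
  assume "X \<simeq> Y"
  then show "C_cpt X = C_cpt Y"
    by (meson C_cpt_mono assms(2) cpt_equiv_imp_le cpt_equiv_sym subset_antisym)
next
  assume eq: "C_cpt X = C_cpt Y"
  show "X \<simeq> Y"
    using evaluation_cpt_equiv[OF assms(2)] cpt_equiv_sym[OF assms(1) evaluation_cpt_equiv[OF assms(1)]]
    unfolding eq by (rule cpt_equiv_trans[rotated])
qed

section \<open>Suprema of Smirnov compactifications\<close>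

text \<open>The hull of a union is the join of regular subrings, which corresponds to the supremum
  of compactifications.\<close>

definition regular_hull :: "(nat \<Rightarrow> real) set \<Rightarrow> (nat \<Rightarrow> real) set" where
  "regular_hull S = \<Inter>{A. regular_subring A \<and> S \<subseteq> A}"

text \<open>Boundedness makes the intersected family nonempty: the ring of all bounded functions
  belongs to it.\<close>

lemma regular_subring_hull:
  assumes "\<And>f. f \<in> S \<Longrightarrow> bounded (range f)"
  shows "regular_subring (regular_hull S)"
  unfolding regular_hull_def
  by (rule regular_subring_Inter) (use regular_subring_bounded assms in auto)

lemma regular_hull_least: "regular_subring A \<Longrightarrow> S \<subseteq> A \<Longrightarrow> regular_hull S \<subseteq> A"
  by (auto simp: regular_hull_def)

lemma regular_hull_superset: "S \<subseteq> regular_hull S"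
  by (auto simp: regular_hull_def)

text \<open>The evaluation compactification of all bounded functions is a largest element, so the
  choice in \<open>beta_omega\<close> succeeds; being below \<open>beta_omega\<close>, it forces
  every bounded function to extend.\<close>

lemma beta_omega:
  "compactification beta_omega" "C_cpt beta_omega = {f. bounded (range f)}"
proof -
  interpret b: regular_subring "{f :: nat \<Rightarrow> real. bounded (range f)}"
    by (rule regular_subring_bounded)
  let ?B = "evaluation_cpt {f. bounded (range f)}"
  have "compactification ?B \<and> (\<forall>X :: point cpt. compactification X \<longrightarrow> X \<preceq> ?B)"
    by (simp add: C_cpt_bounded b.compactification_evaluation_cpt cpt_le_iff b.C_cpt_evaluation_cpt subset_iff)
  then have "compactification beta_omega \<and> (\<forall>X :: point cpt. compactification X \<longrightarrow> X \<preceq> beta_omega)"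
    unfolding beta_omega_def by (rule someI)
  then have le: "?B \<preceq> beta_omega" and c: "compactification beta_omega"
    using b.compactification_evaluation_cpt by blast+
  show "compactification beta_omega"
    by (rule c)
  show "C_cpt beta_omega = {f. bounded (range f)}"
    using C_cpt_mono[OF le] by (auto simp: b.C_cpt_evaluation_cpt dest: C_cpt_bounded)
qed

text \<open>The evaluation compactification of the hull is a supremum, so the choice in
  \<open>cpt_sup\<close> succeeds, and minimality of the chosen supremum bounds its ring by the
  hull.\<close>

lemma cpt_sup:
  assumes "\<And>X. X \<in> \<X> \<Longrightarrow> compactification X"
  shows "compactification (cpt_sup \<X>)" "C_cpt (cpt_sup \<X>) = regular_hull (\<Union>(C_cpt ` \<X>))"
proof -
  let ?S = "\<Union>(C_cpt ` \<X>)"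
  interpret regular_subring "regular_hull ?S"
    by (rule regular_subring_hull) (auto simp: C_cpt_def)
  have hull: "is_cpt_sup \<X> (evaluation_cpt (regular_hull ?S))"
    unfolding is_cpt_sup_def
  proof (intro conjI ballI allI impI)
    show "compactification (evaluation_cpt (regular_hull ?S))"
      by (rule compactification_evaluation_cpt)
    show "X \<preceq> evaluation_cpt (regular_hull ?S)" if "X \<in> \<X>" for X
      using that regular_hull_superset[of ?S]
      by (subst cpt_le_iff) (auto simp: assms compactification_evaluation_cpt C_cpt_evaluation_cpt)
    show "evaluation_cpt (regular_hull ?S) \<preceq> Y"
      if Y: "compactification Y" "\<forall>X\<in>\<X>. X \<preceq> Y" for Y :: "point cpt"
    proof -
      have "regular_hull ?S \<subseteq> C_cpt Y"
        using C_cpt_mono Y by (intro regular_hull_least regular_subring_C_cpt) blast+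
      then show ?thesis
        by (simp add: Y(1) cpt_le_iff compactification_evaluation_cpt C_cpt_evaluation_cpt)
    qed
  qed
  then have sup: "is_cpt_sup \<X> (cpt_sup \<X>)"
    unfolding cpt_sup_def by (rule someI)
  then show c: "compactification (cpt_sup \<X>)"
    by (simp add: is_cpt_sup_def)
  have "cpt_sup \<X> \<preceq> evaluation_cpt (regular_hull ?S)"
    using sup hull unfolding is_cpt_sup_def by blast
  then have "C_cpt (cpt_sup \<X>) \<subseteq> C_cpt (evaluation_cpt (regular_hull ?S))"
    by (rule C_cpt_mono)
  moreover have "regular_hull ?S \<subseteq> C_cpt (cpt_sup \<X>)"
    using sup c C_cpt_mono unfolding is_cpt_sup_def
    by (intro regular_hull_least regular_subring_C_cpt) blast+
  ultimately show "C_cpt (cpt_sup \<X>) = regular_hull ?S"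
    by (simp add: C_cpt_evaluation_cpt)
qed

section \<open>Rings of bounded uniformly continuous functions\<close>

lemma M_omega_triangle: "d \<in> M_omega \<Longrightarrow> d i k \<le> d i j + d j k"
  and M_omega_commute: "d \<in> M_omega \<Longrightarrow> d i j = d j i"
  and M_omega_nonneg: "d \<in> M_omega \<Longrightarrow> 0 \<le> d i j"
  by (auto simp: M_omega_def intro: Metric_space.triangle Metric_space.commute Metric_space.nonneg)

lemma M_omega_isolated:
  assumes "d \<in> M_omega"
  obtains r where "r > 0" "\<And>j. d i j < r \<Longrightarrow> j = i"
proof -
  interpret Metric_space UNIV d
    using assms by (simp add: M_omega_def)
  have "openin mtopology {i}"
    using assms by (simp add: M_omega_def)
  then obtain r where "r > 0" "mball i r \<subseteq> {i}"
    unfolding openin_mtopology by auto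
  then show ?thesis
    using that by (auto simp: subset_iff)
qed

lemma U_star_iff:
  assumes "d \<in> M_omega"
  shows "f \<in> U_star d \<longleftrightarrow> bounded (range f) \<and> (\<forall>\<epsilon>>0. \<exists>\<delta>>0. \<forall>i j. d i j < \<delta> \<longrightarrow> \<bar>f i - f j\<bar> < \<epsilon>)"
proof -
  interpret Metric_space UNIV d
    using assms by (simp add: M_omega_def)
  show ?thesis
    by (simp add: U_star_def uniformly_continuous_map_def dist_real_def) blast
qed

lemma U_starD:
  assumes "d \<in> M_omega" "f \<in> U_star d" "\<epsilon> > 0"
  shows "\<exists>\<delta>>0. \<forall>i j. d i j < \<delta> \<longrightarrow> \<bar>f i - f j\<bar> < \<epsilon>"
  using assms by (simp add: U_star_iff)

lemma regular_subring_U_star: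
  assumes d: "d \<in> M_omega"
  shows "regular_subring (U_star d)"
proof
  interpret b: regular_subring "{f :: nat \<Rightarrow> real. bounded (range f)}"
    by (rule regular_subring_bounded)
  show "bounded (range f)" if "f \<in> U_star d" for f
    using that by (simp add: U_star_def)
  show "(\<lambda>_. c) \<in> U_star d" for c
    by (auto simp: U_star_iff[OF d] intro: exI[of _ 1])
  show "(\<lambda>n. f n + g n) \<in> U_star d" if fg: "f \<in> U_star d" "g \<in> U_star d" for f g
    unfolding U_star_iff[OF d]
  proof (intro conjI allI impI)
    show "bounded (range (\<lambda>n. f n + g n))"
      using b.add[of f g] fg by (simp add: U_star_iff[OF d])
    fix \<epsilon> :: real assume "\<epsilon> > 0"
    then have "\<epsilon> / 2 > 0" by simp
    obtain \<delta> where \<delta>: "\<delta> > 0" "\<And>i j. d i j < \<delta> \<Longrightarrow> \<bar>f i - f j\<bar> < \<epsilon> / 2"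
      using U_starD[OF d fg(1) \<open>\<epsilon> / 2 > 0\<close>] by blast
    obtain \<delta>' where \<delta>': "\<delta>' > 0" "\<And>i j. d i j < \<delta>' \<Longrightarrow> \<bar>g i - g j\<bar> < \<epsilon> / 2"
      using U_starD[OF d fg(2) \<open>\<epsilon> / 2 > 0\<close>] by blast
    have "\<bar>f i + g i - (f j + g j)\<bar> < \<epsilon>" if "d i j < min \<delta> \<delta>'" for i j
      using \<delta>(2)[of i j] \<delta>'(2)[of i j] that by linarith
    then show "\<exists>\<delta>>0. \<forall>i j. d i j < \<delta> \<longrightarrow> \<bar>f i + g i - (f j + g j)\<bar> < \<epsilon>"
      using \<delta>(1) \<delta>'(1) by (intro exI[of _ "min \<delta> \<delta>'"]) simp
  qed
  show "(\<lambda>n. f n * g n) \<in> U_star d" if fg: "f \<in> U_star d" "g \<in> U_star d" for f g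
    unfolding U_star_iff[OF d]
  proof (intro conjI allI impI)
    show "bounded (range (\<lambda>n. f n * g n))"
      using b.mult[of f g] fg by (simp add: U_star_iff[OF d])
    fix \<epsilon> :: real assume "\<epsilon> > 0"
    obtain B where B: "B > 0" "\<And>i. \<bar>f i\<bar> \<le> B"
      using fg(1) unfolding U_star_iff[OF d] bounded_pos by auto
    obtain C where C: "C > 0" "\<And>i. \<bar>g i\<bar> \<le> C"
      using fg(2) unfolding U_star_iff[OF d] bounded_pos by auto
    have pos: "\<epsilon> / (2 * C) > 0" "\<epsilon> / (2 * B) > 0"
      using \<open>\<epsilon> > 0\<close> B(1) C(1) by simp_all
    obtain \<delta> where \<delta>: "\<delta> > 0" "\<And>i j. d i j < \<delta> \<Longrightarrow> \<bar>f i - f j\<bar> < \<epsilon> / (2 * C)"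
      using U_starD[OF d fg(1) pos(1)] by blast
    obtain \<delta>' where \<delta>': "\<delta>' > 0" "\<And>i j. d i j < \<delta>' \<Longrightarrow> \<bar>g i - g j\<bar> < \<epsilon> / (2 * B)"
      using U_starD[OF d fg(2) pos(2)] by blast
    have "\<bar>f i * g i - f j * g j\<bar> < \<epsilon>" if "d i j < min \<delta> \<delta>'" for i j
    proof -
      have "\<bar>f i * g i - f j * g j\<bar> = \<bar>(f i - f j) * g i + f j * (g i - g j)\<bar>"
        by (simp add: algebra_simps)
      also have "\<dots> \<le> \<bar>f i - f j\<bar> * \<bar>g i\<bar> + \<bar>f j\<bar> * \<bar>g i - g j\<bar>"
        by (metis abs_mult abs_triangle_ineq)
      also have "\<dots> \<le> \<bar>f i - f j\<bar> * C + B * \<bar>g i - g j\<bar>"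
        using B C by (intro add_mono mult_left_mono mult_right_mono) auto
      also have "\<dots> < \<epsilon> / (2 * C) * C + B * (\<epsilon> / (2 * B))"
        using \<delta> \<delta>' that B(1) C(1) by (intro add_strict_mono mult_strict_left_mono mult_strict_right_mono) auto
      also have "\<dots> = \<epsilon>"
        using B(1) C(1) by simp
      finally show ?thesis .
    qed
    then show "\<exists>\<delta>>0. \<forall>i j. d i j < \<delta> \<longrightarrow> \<bar>f i * g i - f j * g j\<bar> < \<epsilon>"
      using \<delta>(1) \<delta>'(1) by (intro exI[of _ "min \<delta> \<delta>'"]) simp
  qed
  show "indicator {n} \<in> U_star d" for n
  proof -
    obtain r where r: "r > 0" "\<And>j. d n j < r \<Longrightarrow> j = n"
      using M_omega_isolated[OF d, of n] by metis
    \<comment> \<open>By the choice of \<open>r\<close> and symmetry, points closer than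
      \<open>r\<close> are both equal to \<open>n\<close> or both different from it, so the
      difference vanishes.\<close>
    then have "\<bar>indicator {n} i - indicator {n} j\<bar> < (\<epsilon> :: real)" if "d i j < r" "\<epsilon> > 0" for i j \<epsilon>
      using that M_omega_commute[OF d] by (metis abs_0 diff_self indicator_simps(2) singletonD)
    then show ?thesis
      using b.indicator_singleton[of n] r(1) by (auto simp: U_star_iff[OF d] intro: exI[of _ r])
  qed
  show "f \<in> U_star d" if lim: "\<And>\<epsilon>. \<epsilon> > 0 \<Longrightarrow> \<exists>g\<in>U_star d. \<forall>n. \<bar>f n - g n\<bar> \<le> \<epsilon>" for f
    unfolding U_star_iff[OF d]
  proof (intro conjI allI impI)
    have "f \<in> {f. bounded (range f)}"
    proof (rule b.uniform_limit)
      show "\<exists>g\<in>{f. bounded (range f)}. \<forall>n. \<bar>f n - g n\<bar> \<le> \<epsilon>" if "\<epsilon> > 0" for \<epsilon>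
        using lim[OF that] by (auto simp: U_star_def)
    qed
    then show "bounded (range f)" by simp
    fix \<epsilon> :: real assume "\<epsilon> > 0"
    then have "\<epsilon> / 3 > 0" by simp
    then obtain g where g: "g \<in> U_star d" "\<And>n. \<bar>f n - g n\<bar> \<le> \<epsilon> / 3"
      using lim by metis
    obtain \<delta> where \<delta>: "\<delta> > 0" "\<And>i j. d i j < \<delta> \<Longrightarrow> \<bar>g i - g j\<bar> < \<epsilon> / 3"
      using U_starD[OF d g(1) \<open>\<epsilon> / 3 > 0\<close>] by blast
    have "\<bar>f i - f j\<bar> < \<epsilon>" if "d i j < \<delta>" for i j
      using \<delta>(2)[OF that] g(2)[of i] g(2)[of j] by linarith
    then show "\<exists>\<delta>>0. \<forall>i j. d i j < \<delta> \<longrightarrow> \<bar>f i - f j\<bar> < \<epsilon>"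
      using \<delta>(1) by blast
  qed
qed

text \<open>The choice in \<open>smirnov\<close> has a witness because \<open>U_star d\<close> is
  regular.\<close>

lemma smirnov:
  assumes "d \<in> M_omega"
  shows "compactification (smirnov d)" "C_cpt (smirnov d) = U_star d"
proof -
  interpret regular_subring "U_star d"
    using assms by (rule regular_subring_U_star)
  have "compactification (smirnov d) \<and> C_cpt (smirnov d) = U_star d"
    unfolding smirnov_def
    by (rule someI[of _ "evaluation_cpt (U_star d)"]) (simp add: compactification_evaluation_cpt C_cpt_evaluation_cpt)
  then show "compactification (smirnov d)" "C_cpt (smirnov d) = U_star d"
    by simp_all
qed

text \<open>For \<open>D \<subseteq> M_omega\<close> these are the functions that extend over the
  supremum of the \<open>smirnov d\<close>, \<open>d \<in> D\<close>; suprema are afterwards handled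
  through this ring.\<close>

definition smirnov_ring :: "(nat \<Rightarrow> nat \<Rightarrow> real) set \<Rightarrow> (nat \<Rightarrow> real) set" where
  "smirnov_ring D = regular_hull (\<Union>(U_star ` D))"

lemma regular_subring_smirnov_ring: "regular_subring (smirnov_ring D)"
  unfolding smirnov_ring_def by (rule regular_subring_hull) (auto simp: U_star_def)

lemma beta_omega_equiv_sup_iff:
  assumes "D \<subseteq> M_omega"
  shows "beta_omega \<simeq> cpt_sup (smirnov ` D) \<longleftrightarrow> smirnov_ring D = {f. bounded (range f)}"
proof -
  have "\<And>X. X \<in> smirnov ` D \<Longrightarrow> compactification X"
    using assms smirnov by auto
  note sup = cpt_sup[OF this]
  have "C_cpt ` smirnov ` D = U_star ` D"
    unfolding image_image by (rule image_cong) (use assms smirnov in auto)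
  then have "C_cpt (cpt_sup (smirnov ` D)) = smirnov_ring D"
    by (simp add: sup smirnov_ring_def)
  then show ?thesis
    using cpt_equiv_iff[OF beta_omega(1) sup(1)] beta_omega(2) by auto
qed

section \<open>The proximity of a supremum of metrics\<close>

text \<open>One metric has to serve the whole pair \<open>A\<close>, \<open>B\<close>, so this only
  generates the separation relation of the supremum; the finite colourings below make up for that.
  If \<open>A\<close> or \<open>B\<close> is empty, it asks only for
  \<open>D \<noteq> {}\<close>.\<close>

definition far :: "(nat \<Rightarrow> nat \<Rightarrow> real) set \<Rightarrow> nat set \<Rightarrow> nat set \<Rightarrow> bool" where
  "far D A B \<longleftrightarrow> (\<exists>d\<in>D. \<exists>\<delta>>0. \<forall>i\<in>A. \<forall>j\<in>B. \<delta> \<le> d i j)"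

lemma far_mono: "far D A B \<Longrightarrow> A' \<subseteq> A \<Longrightarrow> B' \<subseteq> B \<Longrightarrow> far D A' B'"
  unfolding far_def by blast

text \<open>Uniform continuity, at scale \<open>\<epsilon>\<close>, with respect to the precompact uniformity induced by
  the proximity of \<open>D\<close>; finite partitions are encoded as colourings.\<close>

definition prox_continuous :: "(nat \<Rightarrow> nat \<Rightarrow> real) set \<Rightarrow> real \<Rightarrow> (nat \<Rightarrow> real) \<Rightarrow> bool" where
  "prox_continuous D \<epsilon> f \<longleftrightarrow> (\<exists>c :: nat \<Rightarrow> nat. finite (range c) \<and>
     (\<forall>k l. (\<forall>i\<in>c -` {k}. \<forall>j\<in>c -` {l}. \<bar>f i - f j\<bar> \<le> \<epsilon>) \<or> far D (c -` {k}) (c -` {l})))"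

text \<open>The common refinement of the two colourings works: a pair of its classes that is not far
  lies in pairs that are not far, so both oscillation bounds apply. This serves sums, products and
  uniform limits alike.\<close>

lemma prox_continuous_combine:
  assumes "prox_continuous D \<epsilon>\<^sub>1 f" "prox_continuous D \<epsilon>\<^sub>2 g"
    and imp: "\<And>i j. \<bar>f i - f j\<bar> \<le> \<epsilon>\<^sub>1 \<Longrightarrow> \<bar>g i - g j\<bar> \<le> \<epsilon>\<^sub>2 \<Longrightarrow> \<bar>h i - h j\<bar> \<le> \<epsilon>"
  shows "prox_continuous D \<epsilon> h"
proof -
  obtain a :: "nat \<Rightarrow> nat" where a: "finite (range a)"
    "\<And>k l. (\<forall>i\<in>a -` {k}. \<forall>j\<in>a -` {l}. \<bar>f i - f j\<bar> \<le> \<epsilon>\<^sub>1) \<or> far D (a -` {k}) (a -` {l})"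
    using assms(1) unfolding prox_continuous_def by metis
  obtain b :: "nat \<Rightarrow> nat" where b: "finite (range b)"
    "\<And>k l. (\<forall>i\<in>b -` {k}. \<forall>j\<in>b -` {l}. \<bar>g i - g j\<bar> \<le> \<epsilon>\<^sub>2) \<or> far D (b -` {k}) (b -` {l})"
    using assms(2) unfolding prox_continuous_def by metis
  define c where "c i = prod_encode (a i, b i)" for i
  have "range c \<subseteq> prod_encode ` (range a \<times> range b)"
    by (auto simp: c_def)
  then have fin: "finite (range c)"
    using a(1) b(1) by (meson finite_SigmaI finite_imageI finite_subset)
  have sub: "c -` {k} \<subseteq> a -` {fst (prod_decode k)}" "c -` {k} \<subseteq> b -` {snd (prod_decode k)}" for k
    by (auto simp: c_def)
  have "(\<forall>i\<in>c -` {k}. \<forall>j\<in>c -` {l}. \<bar>h i - h j\<bar> \<le> \<epsilon>) \<or> far D (c -` {k}) (c -` {l})" for k l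
  proof (cases "far D (c -` {k}) (c -` {l})")
    case False
    then have "\<not> far D (a -` {fst (prod_decode k)}) (a -` {fst (prod_decode l)})"
      "\<not> far D (b -` {snd (prod_decode k)}) (b -` {snd (prod_decode l)})"
      using far_mono sub by metis+
    then have "\<bar>h i - h j\<bar> \<le> \<epsilon>" if "i \<in> c -` {k}" "j \<in> c -` {l}" for i j
      using a(2)[of "fst (prod_decode k)" "fst (prod_decode l)"]
        b(2)[of "snd (prod_decode k)" "snd (prod_decode l)"]
        sub[of k, THEN subsetD, OF that(1)] sub[of l, THEN subsetD, OF that(2)] imp[of i j]
      by blast
    then show ?thesis
      by blast
  qed blast
  then show ?thesis
    unfolding prox_continuous_def using fin by blast
qed

lemma prox_continuous_const: "\<epsilon> \<ge> 0 \<Longrightarrow> prox_continuous D \<epsilon> (\<lambda>_. c)"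
  by (auto simp: prox_continuous_def intro!: exI[of _ "\<lambda>_. 0"])

text \<open>The colour of \<open>i\<close> is the interval of length \<open>\<epsilon> / 2\<close>
  that contains \<open>f i\<close>. Equal or adjacent intervals keep values within \<epsilon>;
  otherwise the values differ by more than \<open>\<epsilon> / 2\<close>, and uniform continuity
  keeps the points \<delta>-apart.\<close>

lemma prox_continuous_U_star:
  assumes "d \<in> D" "d \<in> M_omega" "f \<in> U_star d" "\<epsilon> > 0"
  shows "prox_continuous D \<epsilon> f"
proof -
  define m where "m i = \<lfloor>f i / (\<epsilon> / 2)\<rfloor>" for i
  obtain B where B: "\<And>i. \<bar>f i\<bar> \<le> B"
    using assms(3) by (auto simp: U_star_def bounded_iff)
  have "m i \<in> {\<lfloor>- B / (\<epsilon> / 2)\<rfloor>..\<lfloor>B / (\<epsilon> / 2)\<rfloor>}" for i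
    unfolding m_def atLeastAtMost_iff using B[of i] assms(4)
    by (intro conjI floor_mono divide_right_mono) auto
  then have "finite (range m)"
    by (meson finite_atLeastAtMost_int finite_subset image_subsetI)
  then have "finite (range (to_nat \<circ> m))"
    by (metis finite_imageI image_comp)
  have m: "of_int (m i) * (\<epsilon> / 2) \<le> f i" "f i < (of_int (m i) + 1) * (\<epsilon> / 2)" for i
    unfolding m_def using assms(4) floor_divide_lower floor_divide_upper by auto
  obtain \<delta> where \<delta>: "\<delta> > 0" "\<And>i j. d i j < \<delta> \<Longrightarrow> \<bar>f i - f j\<bar> < \<epsilon> / 2"
    using U_starD[OF assms(2,3) half_gt_zero[OF assms(4)]] by blast
  have near: "\<bar>f i - f j\<bar> \<le> \<epsilon>" if "\<bar>m i - m j\<bar> \<le> 1" for i j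
  proof -
    have "(of_int (m i) - of_int (m j) + 1) * (\<epsilon> / 2) \<le> 2 * (\<epsilon> / 2)"
      "(of_int (m j) - of_int (m i) + 1) * (\<epsilon> / 2) \<le> 2 * (\<epsilon> / 2)"
      using that assms(4) by (intro mult_right_mono; linarith)+
    then show ?thesis
      using m[of i] m[of j] by (simp add: algebra_simps)
  qed
  have "d i j \<ge> \<delta>" if "\<not> \<bar>m i - m j\<bar> \<le> 1" for i j
  proof (rule ccontr)
    assume "\<not> \<delta> \<le> d i j"
    then have lt: "\<bar>f i - f j\<bar> < \<epsilon> / 2"
      using \<delta>(2) by simp
    have "m j + 2 \<le> m i \<or> m i + 2 \<le> m j"
      using that by linarith
    then show False
    proof
      assume "m j + 2 \<le> m i"
      then have "(of_int (m j) + 2) * (\<epsilon> / 2) \<le> of_int (m i) * (\<epsilon> / 2)"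
        using assms(4) by (intro mult_right_mono) linarith+
      then show False
        using lt m[of i] m[of j] by (simp add: algebra_simps)
    next
      assume "m i + 2 \<le> m j"
      then have "(of_int (m i) + 2) * (\<epsilon> / 2) \<le> of_int (m j) * (\<epsilon> / 2)"
        using assms(4) by (intro mult_right_mono) linarith+
      then show False
        using lt m[of i] m[of j] by (simp add: algebra_simps)
    qed
  qed
  note apart = this
  have "(\<forall>i\<in>(to_nat \<circ> m) -` {k}. \<forall>j\<in>(to_nat \<circ> m) -` {l}. \<bar>f i - f j\<bar> \<le> \<epsilon>) \<or>
      far D ((to_nat \<circ> m) -` {k}) ((to_nat \<circ> m) -` {l})" for k l
  \<comment> \<open>A colour determines its interval, so one pair with non-adjacent intervals makes
    all pairs from these two classes such.\<close>
  proof (cases "\<exists>i j. to_nat (m i) = k \<and> to_nat (m j) = l \<and> \<not> \<bar>m i - m j\<bar> \<le> 1")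
    case True
    then obtain i' j' where ij: "to_nat (m i') = k" "to_nat (m j') = l" "\<not> \<bar>m i' - m j'\<bar> \<le> 1"
      by blast
    have "\<delta> \<le> d i j" if "i \<in> (to_nat \<circ> m) -` {k}" "j \<in> (to_nat \<circ> m) -` {l}" for i j
    proof (rule apart)
      have "to_nat (m i) = to_nat (m i')" "to_nat (m j) = to_nat (m j')"
        using that by (simp_all add: ij(1,2))
      then have "m i = m i'" "m j = m j'"
        by (simp_all only: inj_eq[OF inj_to_nat])
      then show "\<not> \<bar>m i - m j\<bar> \<le> 1"
        using ij(3) by simp
    qed
    then show ?thesis
      using \<open>d \<in> D\<close> \<delta>(1) unfolding far_def by blast
  next
    case False
    then show ?thesis
      using near by (auto simp: not_le)
  qed
  then show ?thesis
    unfolding prox_continuous_def using \<open>finite (range (to_nat \<circ> m))\<close> by blast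
qed

text \<open>The bounded functions with this property at all scales form a regular subring that
  contains every \<open>U_star d\<close>, hence also the hull.\<close>

lemma smirnov_ring_prox_continuous:
  assumes D: "D \<subseteq> M_omega" "D \<noteq> {}" and "f \<in> smirnov_ring D" "\<epsilon> > 0"
  shows "prox_continuous D \<epsilon> f"
proof -
  define P where "P = {f. bounded (range f) \<and> (\<forall>\<epsilon>>0. prox_continuous D \<epsilon> f)}"
  interpret b: regular_subring "{f :: nat \<Rightarrow> real. bounded (range f)}"
    by (rule regular_subring_bounded)
  have U: "U_star d \<subseteq> P" if "d \<in> D" for d
    using that D(1) prox_continuous_U_star by (auto simp: P_def U_star_def)
  have "regular_subring P"
  proof
    show "bounded (range f)" if "f \<in> P" for f
      using that by (simp add: P_def)
    show "(\<lambda>_. c) \<in> P" for c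
      by (simp add: P_def prox_continuous_const)
    \<comment> \<open>Inherited from \<open>U_star d\<close> for any \<open>d \<in> D\<close>; this
      is where \<open>D \<noteq> {}\<close> enters.\<close>
    show "indicator {n} \<in> P" for n
      using D U regular_subring.indicator_singleton[OF regular_subring_U_star] by blast
    show "(\<lambda>n. f n + g n) \<in> P" if fg: "f \<in> P" "g \<in> P" for f g
    proof -
      have "prox_continuous D \<epsilon> (\<lambda>n. f n + g n)" if "\<epsilon> > 0" for \<epsilon>
      proof (rule prox_continuous_combine)
        show "prox_continuous D (\<epsilon> / 2) f" "prox_continuous D (\<epsilon> / 2) g"
          using fg that by (auto simp: P_def)
      qed linarith
      then show ?thesis
        using b.add[of f g] fg by (simp add: P_def)
    qed
    show "(\<lambda>n. f n * g n) \<in> P" if fg: "f \<in> P" "g \<in> P" for f g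
    proof -
      obtain B where B: "B > 0" "\<And>i. \<bar>f i\<bar> \<le> B"
        using fg(1) unfolding P_def bounded_pos by auto
      obtain C where C: "C > 0" "\<And>i. \<bar>g i\<bar> \<le> C"
        using fg(2) unfolding P_def bounded_pos by auto
      have "prox_continuous D \<epsilon> (\<lambda>n. f n * g n)" if "\<epsilon> > 0" for \<epsilon>
      proof (rule prox_continuous_combine)
        show "prox_continuous D (\<epsilon> / (2 * C)) f" "prox_continuous D (\<epsilon> / (2 * B)) g"
          using fg that B(1) C(1) by (auto simp: P_def)
        fix i j assume le: "\<bar>f i - f j\<bar> \<le> \<epsilon> / (2 * C)" "\<bar>g i - g j\<bar> \<le> \<epsilon> / (2 * B)"
        have "\<bar>f i * g i - f j * g j\<bar> = \<bar>(f i - f j) * g i + f j * (g i - g j)\<bar>"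
          by (simp add: algebra_simps)
        also have "\<dots> \<le> \<bar>f i - f j\<bar> * \<bar>g i\<bar> + \<bar>f j\<bar> * \<bar>g i - g j\<bar>"
          by (metis abs_mult abs_triangle_ineq)
        also have "\<dots> \<le> \<epsilon> / (2 * C) * C + B * (\<epsilon> / (2 * B))"
          using le B C that by (intro add_mono mult_mono) auto
        also have "\<dots> = \<epsilon>"
          using B(1) C(1) by simp
        finally show "\<bar>f i * g i - f j * g j\<bar> \<le> \<epsilon>" .
      qed
      then show ?thesis
        using b.mult[of f g] fg by (simp add: P_def)
    qed
    show "f \<in> P" if lim: "\<And>\<epsilon>. \<epsilon> > 0 \<Longrightarrow> \<exists>g\<in>P. \<forall>n. \<bar>f n - g n\<bar> \<le> \<epsilon>" for f
    proof -
      have "prox_continuous D \<epsilon> f" if "\<epsilon> > 0" for \<epsilon>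
      proof -
        have "\<epsilon> / 3 > 0"
          using that by simp
        then obtain g where g: "g \<in> P" "\<And>n. \<bar>f n - g n\<bar> \<le> \<epsilon> / 3"
          using lim by metis
        then have prox_continuous: "prox_continuous D (\<epsilon> / 3) g"
          using \<open>\<epsilon> / 3 > 0\<close> by (simp add: P_def)
        show ?thesis
        proof (rule prox_continuous_combine[OF prox_continuous prox_continuous])
          fix i j assume "\<bar>g i - g j\<bar> \<le> \<epsilon> / 3"
          then show "\<bar>f i - f j\<bar> \<le> \<epsilon>"
            using g(2)[of i] g(2)[of j] by linarith
        qed
      qed
      moreover have "f \<in> {f. bounded (range f)}"
      proof (rule b.uniform_limit)
        show "\<exists>g\<in>{f. bounded (range f)}. \<forall>n. \<bar>f n - g n\<bar> \<le> \<epsilon>" if "\<epsilon> > 0" for \<epsilon>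
          using lim[OF that] by (auto simp: P_def)
      qed
      ultimately show ?thesis
        by (simp add: P_def)
    qed
  qed
  then have "smirnov_ring D \<subseteq> P"
    unfolding smirnov_ring_def using U by (intro regular_hull_least) auto
  then show ?thesis
    using assms(3,4) by (auto simp: P_def)
qed

text \<open>For nonempty \<open>D \<subseteq> M_omega\<close> these are exactly the 0-1 sequences in
  \<open>smirnov_ring D\<close>, described simply enough to be coded in the Baire space.\<close>

definition separated :: "(nat \<Rightarrow> nat \<Rightarrow> real) set \<Rightarrow> (nat \<Rightarrow> bool) \<Rightarrow> bool" where
  "separated D x \<longleftrightarrow> (\<exists>c :: nat \<Rightarrow> nat. finite (range c) \<and>
     (\<forall>k l. far D {i. c i = k \<and> x i} {j. c j = l \<and> \<not> x j}))"

lemma separated_if_smirnov_ring: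
  assumes D: "D \<subseteq> M_omega" "D \<noteq> {}" and x: "(\<lambda>n. of_bool (x n)) \<in> smirnov_ring D"
  shows "separated D x"
proof -
  \<comment> \<open>Any positive scale below 1 would do: values of a 0-1 sequence within 1/2 of each
    other are equal.\<close>
  have "prox_continuous D (1/2) (\<lambda>n. of_bool (x n))"
    using smirnov_ring_prox_continuous[OF D x] by simp
  then obtain c :: "nat \<Rightarrow> nat" where c: "finite (range c)"
    "\<And>k l. (\<forall>i\<in>c -` {k}. \<forall>j\<in>c -` {l}. \<bar>of_bool (x i) - of_bool (x j)\<bar> \<le> (1/2 :: real)) \<or> far D (c -` {k}) (c -` {l})"
    unfolding prox_continuous_def by metis
  have "far D {i. c i = k \<and> x i} {j. c j = l \<and> \<not> x j}" for k l
  proof (cases "far D (c -` {k}) (c -` {l})")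
    case True
    then show ?thesis
      by (rule far_mono) auto
  next
    case False
    then have "\<bar>of_bool (x i) - of_bool (x j)\<bar> \<le> (1/2 :: real)" if "c i = k" "c j = l" for i j
      using c(2)[of k l] that by auto
    \<comment> \<open>Hence one of the two sets is empty, and any metric in \<open>D\<close> serves
      vacuously.\<close>
    then have none: "\<not> (x i \<and> \<not> x j)" if "c i = k" "c j = l" for i j
      using that by fastforce
    obtain d where "d \<in> D"
      using D(2) by blast
    then show ?thesis
      unfolding far_def using none by (intro bexI[of _ d] exI[of _ 1]) auto
  qed
  then show ?thesis
    unfolding separated_def using c(1) by blast
qed

text \<open>One metric is needed for each pair of used colours, and there are finitely many such
  pairs.\<close>

lemma separated_finite_subset:
  assumes "separated D x"
  obtains F where "F \<subseteq> D" "finite F" "F \<noteq> {}" "separated F x"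
proof -
  obtain c :: "nat \<Rightarrow> nat" where c: "finite (range c)"
    and "\<And>k l. far D {i. c i = k \<and> x i} {j. c j = l \<and> \<not> x j}"
    using assms unfolding separated_def by blast
  then have "\<exists>d. d \<in> D \<and> far {d} {i. c i = k \<and> x i} {j. c j = l \<and> \<not> x j}" for k l
    unfolding far_def by blast
  then have "\<exists>d. \<forall>k l. d k l \<in> D \<and> far {d k l} {i. c i = k \<and> x i} {j. c j = l \<and> \<not> x j}"
    by (intro choice allI)
  then obtain d where d: "\<And>k l. d k l \<in> D"
    and far: "\<And>k l. far {d k l} {i. c i = k \<and> x i} {j. c j = l \<and> \<not> x j}"
    by blast
  define F where "F = (\<lambda>(k, l). d k l) ` (range c \<times> range c)"
  have dF: "d (c i) (c j) \<in> F" for i j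
    by (auto simp: F_def)
  have "far F {i. c i = k \<and> x i} {j. c j = l \<and> \<not> x j}" for k l
  proof (cases "k \<in> range c \<and> l \<in> range c")
    case True
    then have "d k l \<in> F"
      using dF by blast
    then show ?thesis
      using far[of k l] unfolding far_def by blast
  next
    case False
    then have "{i. c i = k \<and> x i} = {} \<or> {j. c j = l \<and> \<not> x j} = {}"
      by blast
    then have "\<forall>i\<in>{i. c i = k \<and> x i}. \<forall>j\<in>{j. c j = l \<and> \<not> x j}. 1 \<le> d (c 0) (c 0) i j"
      by blast
    then show ?thesis
      using dF[of 0 0] zero_less_one unfolding far_def by blast
  qed
  then have "separated F x"
    unfolding separated_def using c by blast
  moreover have "F \<subseteq> D" "finite F" "F \<noteq> {}"
    using d c by (auto simp: F_def)
  ultimately show ?thesis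
    using that by blast
qed

text \<open>The function is the distance to \<open>B\<close>, truncated at \<delta> and divided by
  \<delta>; it is Lipschitz, hence uniformly continuous.\<close>

lemma far_imp_separating_function:
  assumes "D \<subseteq> M_omega" "far D A B"
  obtains f where "f \<in> smirnov_ring D" "\<And>i. i \<in> A \<Longrightarrow> f i = 1" "\<And>j. j \<in> B \<Longrightarrow> f j = 0"
proof -
  obtain d \<delta> where d: "d \<in> D" and \<delta>: "\<delta> > 0" "\<And>i j. i \<in> A \<Longrightarrow> j \<in> B \<Longrightarrow> \<delta> \<le> d i j"
    using assms(2) unfolding far_def by blast
  have dM: "d \<in> M_omega"
    using assms(1) d by blast
  \<comment> \<open>Inserting \<delta> truncates the distance and also covers an empty
    \<open>B\<close>.\<close>
  define g where "g i = Inf (insert \<delta> (d i ` B))" for i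
  have bdd: "bdd_below (insert \<delta> (d i ` B))" for i
    using M_omega_nonneg[OF dM] \<delta>(1) by (intro bdd_belowI[of _ 0]) auto
  have g0: "0 \<le> g i" for i
    unfolding g_def by (rule cInf_greatest) (use M_omega_nonneg[OF dM] \<delta>(1) in auto)
  have g\<delta>: "g i \<le> \<delta>" for i
    unfolding g_def by (rule cInf_lower) (use bdd in auto)
  have gd: "g i \<le> d i j" if "j \<in> B" for i j
    unfolding g_def by (rule cInf_lower) (use bdd that in auto)
  have "g i - d i i' \<le> g i'" for i i'
    unfolding g_def[of i']
  proof (rule cInf_greatest)
    fix y assume "y \<in> insert \<delta> (d i' ` B)"
    then consider "y = \<delta>" | j where "j \<in> B" "y = d i' j"
      by blast
    then show "g i - d i i' \<le> y"
    proof cases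
      case 1
      then show ?thesis
        using g\<delta>[of i] M_omega_nonneg[OF dM, of i i'] by linarith
    next
      case 2
      then show ?thesis
        using gd[of j i] M_omega_triangle[OF dM, of i j i'] by linarith
    qed
  qed simp
  then have lip: "\<bar>g i - g j\<bar> \<le> d i j" for i j
    using M_omega_commute[OF dM, of i j] by (smt (verit))
  let ?f = "\<lambda>i. g i / \<delta>"
  have "?f \<in> U_star d"
    unfolding U_star_iff[OF dM]
  proof (intro conjI allI impI)
    have "\<bar>?f i\<bar> \<le> 1" for i
      using g0[of i] g\<delta>[of i] \<delta>(1) by simp
    then show "bounded (range ?f)"
      by (auto simp: bounded_iff)
    fix \<epsilon> :: real assume "\<epsilon> > 0"
    have "\<bar>?f i - ?f j\<bar> < \<epsilon>" if "d i j < \<epsilon> * \<delta>" for i j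
    proof -
      have "\<bar>?f i - ?f j\<bar> = \<bar>g i - g j\<bar> / \<delta>"
        using \<delta>(1) by (simp flip: diff_divide_distrib)
      also have "\<dots> < \<epsilon>"
        using lip[of i j] that \<delta>(1) by (simp add: field_simps)
      finally show ?thesis .
    qed
    then show "\<exists>\<delta>>0. \<forall>i j. d i j < \<delta> \<longrightarrow> \<bar>?f i - ?f j\<bar> < \<epsilon>"
      using \<open>\<epsilon> > 0\<close> \<delta>(1) by (intro exI[of _ "\<epsilon> * \<delta>"]) simp
  qed
  then have "?f \<in> smirnov_ring D"
    using d regular_hull_superset unfolding smirnov_ring_def by blast
  moreover have "?f i = 1" if "i \<in> A" for i
  proof -
    have "\<delta> \<le> g i"
      unfolding g_def by (rule cInf_greatest) (use \<delta>(2) that in auto)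
    then show ?thesis
      using g\<delta>[of i] \<delta>(1) by simp
  qed
  moreover have "?f j = 0" if "j \<in> B" for j
  proof -
    have "d j j = 0"
      using dM Metric_space.mdist_zero[of UNIV d] by (simp add: M_omega_def)
    then show ?thesis
      using g0[of j] gd[OF that, of j] by simp
  qed
  ultimately show ?thesis
    by (rule that)
qed

text \<open>A function \<open>f k l\<close> is 1 on the ones of colour \<open>k\<close> and 0 on the
  zeros of colour \<open>l\<close>. Multiplying over \<open>l\<close> gives 0 at all zeros and keeps
  1 at the ones of colour \<open>k\<close>; one minus the product of the complements then acts as a
  disjunction over \<open>k\<close>.\<close>

lemma smirnov_ring_if_separated:
  assumes D: "D \<subseteq> M_omega" and "separated D x"
  shows "(\<lambda>n. of_bool (x n)) \<in> smirnov_ring D"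
proof -
  interpret regular_subring "smirnov_ring D"
    by (rule regular_subring_smirnov_ring)
  obtain c :: "nat \<Rightarrow> nat" where c: "finite (range c)"
    and far: "\<And>k l. far D {i. c i = k \<and> x i} {j. c j = l \<and> \<not> x j}"
    using assms(2) unfolding separated_def by blast
  have "\<exists>f. f \<in> smirnov_ring D \<and> (\<forall>i. c i = k \<and> x i \<longrightarrow> f i = 1) \<and> (\<forall>j. c j = l \<and> \<not> x j \<longrightarrow> f j = 0)" for k l
    by (rule far_imp_separating_function[OF D far[of k l]]) blast
  then have "\<exists>f. \<forall>k l. f k l \<in> smirnov_ring D \<and> (\<forall>i. c i = k \<and> x i \<longrightarrow> f k l i = 1) \<and> (\<forall>j. c j = l \<and> \<not> x j \<longrightarrow> f k l j = 0)"
    by (intro choice allI)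
  then obtain f where f: "\<And>k l. f k l \<in> smirnov_ring D"
    and f1: "\<And>l i. x i \<Longrightarrow> f (c i) l i = 1" and f0: "\<And>k j. \<not> x j \<Longrightarrow> f k (c j) j = 0"
    by blast
  have "(\<lambda>n. 1 - (\<Prod>k\<in>range c. 1 - (\<Prod>l\<in>range c. f k l n))) \<in> smirnov_ring D"
    by (intro diff const prod c f)
  also have "(\<lambda>n. 1 - (\<Prod>k\<in>range c. 1 - (\<Prod>l\<in>range c. f k l n))) = (\<lambda>n. of_bool (x n))"
  proof
    fix n
    show "1 - (\<Prod>k\<in>range c. 1 - (\<Prod>l\<in>range c. f k l n)) = of_bool (x n)"
    proof (cases "x n")
      case True
      then have "(\<Prod>l\<in>range c. f (c n) l n) = 1"
        by (simp add: f1)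
      then have "(\<Prod>k\<in>range c. 1 - (\<Prod>l\<in>range c. f k l n)) = 0"
        using c by (intro prod_zero bexI[of _ "c n"]) auto
      then show ?thesis
        using True by simp
    next
      case False
      then have "(\<Prod>l\<in>range c. f k l n) = 0" for k
        using c f0[of n k] by (intro prod_zero bexI[of _ "c n"]) auto
      then show ?thesis
        using False by simp
    qed
  qed
  finally show ?thesis .
qed

section \<open>Analytic sets\<close>

lemma openin_baire_space_cylinder: "openin baire_space {z. \<forall>i<m. z i = y i}"
proof -
  have "openin baire_space (\<Pi>\<^sub>E i\<in>UNIV. if i < m then {y i} else UNIV)"
    unfolding baire_space_def
    by (rule product_topology_basis) (auto intro: finite_subset[of _ "{..<m}"])
  also have "(\<Pi>\<^sub>E i\<in>UNIV. if i < m then {y i} else UNIV) = {z. \<forall>i<m. z i = y i}"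
    by (auto simp: PiE_def Pi_def split: if_splits)
  finally show ?thesis .
qed

lemma continuous_map_baire_cantor:
  assumes "\<And>y n. \<exists>m. \<forall>z. (\<forall>i<m. z i = y i) \<longrightarrow> f z n = f y n"
  shows "continuous_map baire_space cantor_space f"
proof -
  have "continuous_map baire_space (discrete_topology UNIV) (\<lambda>y. f y n)" for n
  proof -
    have "openin baire_space {y. f y n \<in> U}" for U
      unfolding openin_subopen[of _ "{y. f y n \<in> U}"]
    proof
      fix y assume y: "y \<in> {y. f y n \<in> U}"
      obtain m where m: "\<And>z. \<forall>i<m. z i = y i \<Longrightarrow> f z n = f y n"
        using assms[of y n] by blast
      have "z \<in> {y. f y n \<in> U}" if "z \<in> {z. \<forall>i<m. z i = y i}" for z
        using m[of z] that y by simp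
      then have "{z. \<forall>i<m. z i = y i} \<subseteq> {y. f y n \<in> U}"
        by (rule subsetI)
      moreover have "y \<in> {z. \<forall>i<m. z i = y i}"
        by simp
      ultimately show "\<exists>T. openin baire_space T \<and> y \<in> T \<and> T \<subseteq> {y. f y n \<in> U}"
        using openin_baire_space_cylinder by blast
    qed
    moreover have "topspace baire_space = UNIV"
      by (simp add: baire_space_def)
    ultimately show ?thesis
      by (simp add: continuous_map_def)
  qed
  then show ?thesis
    by (simp add: cantor_space_def continuous_map_componentwise_UNIV)
qed

text \<open>A nonempty closed set \<open>C\<close> is a retract of the Baire space: a point outside \<open>C\<close> is sent to
  a point of \<open>C\<close> that depends only on the longest prefix it shares with a point of \<open>C\<close>.\<close>

lemma analytic_image_closed:
  fixes C :: "(nat \<Rightarrow> nat) set"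
  assumes closed: "\<And>y. y \<notin> C \<Longrightarrow> \<exists>m. \<forall>z\<in>C. \<exists>i<m. z i \<noteq> y i"
    and cont: "\<And>y n. \<exists>m. \<forall>z. (\<forall>i<m. z i = y i) \<longrightarrow> g z n = g y n"
  shows "analytic (g ` C)"
proof (cases "C = {}")
  case True
  then show ?thesis
    by (simp add: analytic_def)
next
  case False
  define shared where "shared m y \<longleftrightarrow> (\<exists>z\<in>C. \<forall>i<m. z i = y i)" for m and y :: "nat \<Rightarrow> nat"
  \<comment> \<open>This is used off \<open>C\<close> only, where closedness bounds the shared
    prefixes; on \<open>C\<close> the map \<open>r\<close> is the identity.\<close>
  define M where "M y = (GREATEST m. shared m y)" for y
  define r where "r y = (if y \<in> C then y else SOME z. z \<in> C \<and> (\<forall>i<M y. z i = y i))" for y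
  have shared_mono: "shared l y" if "shared m y" "l \<le> m" for l m y
    using that unfolding shared_def by (meson order_less_le_trans)
  have shared_cong: "shared l z \<longleftrightarrow> shared l y" if "\<forall>i<m. z i = y i" "l \<le> m" for l m y z
    using that unfolding shared_def by (metis order_less_le_trans)
  have M: "shared (M y) y" "\<And>m. shared m y \<Longrightarrow> m \<le> M y" if y: "y \<notin> C" for y
  proof -
    have "shared 0 y"
      using False by (auto simp: shared_def)
    obtain b where "\<not> shared b y"
      using closed[OF y] unfolding shared_def by blast
    then have b: "m \<le> b" if "shared m y" for m
      using shared_mono[OF that, of b] by linarith
    show "shared (M y) y"
      unfolding M_def by (rule GreatestI_nat[of "\<lambda>m. shared m y" 0 b, OF \<open>shared 0 y\<close> b])
    show "m \<le> M y" if "shared m y" for m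
      unfolding M_def by (rule Greatest_le_nat[of "\<lambda>m. shared m y" m b, OF that b])
  qed
  have rM: "r y \<in> C" "\<forall>i<M y. r y i = y i" if "y \<notin> C" for y
  proof -
    have "\<exists>z. z \<in> C \<and> (\<forall>i<M y. z i = y i)"
      using M(1)[OF that] by (auto simp: shared_def)
    from someI_ex[OF this] show "r y \<in> C" "\<forall>i<M y. r y i = y i"
      using that by (simp_all add: r_def)
  qed
  have "\<exists>m. \<forall>z. (\<forall>i<m. z i = y i) \<longrightarrow> g (r z) n = g (r y) n" for y n
  proof (cases "y \<in> C")
    case True
    obtain m where m: "\<And>z. \<forall>i<m. z i = y i \<Longrightarrow> g z n = g y n"
      using cont by blast
    have "g (r z) n = g y n" if z: "\<forall>i<m. z i = y i" for z
    proof (rule m)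
      show "\<forall>i<m. r z i = y i"
      proof (cases "z \<in> C")
        case True
        then show ?thesis
          using z by (simp add: r_def)
      next
        case False
        \<comment> \<open>As \<open>z\<close> shares a prefix of length \<open>m\<close> with
          \<open>y \<in> C\<close>, \<open>m \<le> M z\<close>; so \<open>r z\<close> agrees with
          \<open>z\<close>, hence with \<open>y\<close>, on that prefix.\<close>
        have "shared m z"
          using \<open>y \<in> C\<close> z by (auto simp: shared_def)
        then show ?thesis
          using M(2)[OF False] rM(2)[OF False] z by (metis order_less_le_trans)
      qed
    qed
    moreover have "r y = y"
      using True by (simp add: r_def)
    ultimately show ?thesis
      by metis
  next
    case False
    \<comment> \<open>One place beyond the longest shared prefix: agreement with \<open>y\<close> up
      to there keeps \<open>z\<close> outside \<open>C\<close> with \<open>M z = M y\<close>, so the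
      choice operator is applied to the same predicate for both.\<close>
    have "r z = r y" if z: "\<forall>i<Suc (M y). z i = y i" for z
    proof -
      have not: "\<not> shared (Suc (M y)) y"
        using M(2)[OF False, of "Suc (M y)"] by auto
      then have "z \<notin> C"
        using z by (auto simp: shared_def)
      have "\<not> shared (Suc (M y)) z"
        using shared_cong[OF z, of "Suc (M y)"] not by simp
      then have "M z \<le> M y"
        using M(1)[OF \<open>z \<notin> C\<close>] shared_mono[of "M z" z "Suc (M y)"] by linarith
      moreover have "M y \<le> M z"
        using M(2)[OF \<open>z \<notin> C\<close>] shared_cong[OF z, of "M y"] M(1)[OF False] by simp
      ultimately have "M z = M y"
        by simp
      then have "(\<lambda>w. w \<in> C \<and> (\<forall>i<M z. w i = z i)) = (\<lambda>w. w \<in> C \<and> (\<forall>i<M y. w i = y i))"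
        using z by (auto simp: fun_eq_iff)
      then show ?thesis
        using False \<open>z \<notin> C\<close> by (simp add: r_def)
    qed
    then show ?thesis
      by metis
  qed
  then have "continuous_map baire_space cantor_space (g \<circ> r)"
    by (intro continuous_map_baire_cantor) (simp only: comp_apply)
  moreover have "range r = C"
  proof
    show "range r \<subseteq> C"
      using rM(1) by (auto simp: r_def)
    show "C \<subseteq> range r"
    proof
      fix y assume "y \<in> C"
      then have "y = r y"
        by (simp add: r_def)
      then show "y \<in> range r"
        by (metis rangeI)
    qed
  qed
  then have "range (g \<circ> r) = g ` C"
    by (metis image_comp)
  ultimately show ?thesis
    unfolding analytic_def by blast
qed

text \<open>A separated sequence is coded in the Baire space together with a bound \<open>N\<close> for the
  colours, the colouring and a table assigning to two colours the index of a metric for which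
  their classes are \<open>1/(N+1)\<close>-apart. The codes form a closed set.\<close>

lemma analytic_separated:
  assumes "finite F" "F \<noteq> {}"
  shows "analytic {x. separated F x}"
proof -
  \<comment> \<open>Enumerating \<open>F\<close> by all natural numbers, with repetitions, makes
    every number a valid table entry.\<close>
  obtain e :: "nat \<Rightarrow> nat \<Rightarrow> nat \<Rightarrow> real" where e: "range e = F"
    using range_from_nat_into[OF assms(2) countable_finite[OF assms(1)]] by blast
  \<comment> \<open>The tags 0 to 3 in the first component of the pairing interleave the four parts
    of a code in one sequence.\<close>
  define N where "N y = y (prod_encode (0, 0))" for y :: "nat \<Rightarrow> nat"
  define X where "X y i \<longleftrightarrow> y (prod_encode (1, i)) \<noteq> 0" for y :: "nat \<Rightarrow> nat" and i
  define c where "c y i = y (prod_encode (2, i))" for y :: "nat \<Rightarrow> nat" and i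
  define t where "t y k l = y (prod_encode (3, prod_encode (k, l)))" for y :: "nat \<Rightarrow> nat" and k l
  define C where "C = {y. (\<forall>i. c y i \<le> N y) \<and>
    (\<forall>i j. X y i \<longrightarrow> \<not> X y j \<longrightarrow> 1 / Suc (N y) \<le> e (t y (c y i) (c y j)) i j)}"
  have "analytic (X ` C)"
  proof (rule analytic_image_closed)
    \<comment> \<open>A violated condition reads only finitely many coordinates, so it stays
      violated for every \<open>z\<close> that agrees with \<open>y\<close> on a long enough
      prefix.\<close>
    fix y assume "y \<notin> C"
    then consider i where "\<not> c y i \<le> N y"
      | i j where "X y i" "\<not> X y j" "\<not> 1 / Suc (N y) \<le> e (t y (c y i) (c y j)) i j"
      unfolding C_def by blast
    then show "\<exists>m. \<forall>z\<in>C. \<exists>i<m. z i \<noteq> y i"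
    proof cases
      case 1
      define m where "m = Suc (max (prod_encode (2, i)) (prod_encode (0, 0)))"
      have "z \<notin> C" if z: "\<forall>i<m. z i = y i" for z
      proof -
        have "c z i = c y i" "N z = N y"
          using z by (auto simp: m_def c_def N_def)
        then show ?thesis
          using 1 unfolding C_def by (metis (mono_tags, lifting) mem_Collect_eq)
      qed
      then show ?thesis
        by blast
    next
      case 2
      define S where "S = {prod_encode (0, 0), prod_encode (1, i), prod_encode (1, j),
        prod_encode (2, i), prod_encode (2, j), prod_encode (3, prod_encode (c y i, c y j))}"
      have "z \<notin> C" if z: "\<forall>i<Suc (Max S). z i = y i" for z
      proof -
        have "finite S"
          by (simp add: S_def)
        then have "p < Suc (Max S)" if "p \<in> S" for p
          using that by (simp add: less_Suc_eq_le)
        then have "z p = y p" if "p \<in> S" for p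
          using z that by blast
        then have "N z = N y" "X z i = X y i" "X z j = X y j" "c z i = c y i" "c z j = c y j"
          "t z (c y i) (c y j) = t y (c y i) (c y j)"
          by (simp_all add: S_def N_def X_def c_def t_def)
        then have "X z i" "\<not> X z j" "\<not> 1 / Suc (N z) \<le> e (t z (c z i) (c z j)) i j"
          using 2 by simp_all
        then show ?thesis
          unfolding C_def by blast
      qed
      then show ?thesis
        by blast
    qed
  next
    fix y :: "nat \<Rightarrow> nat" and n
    show "\<exists>m. \<forall>z. (\<forall>i<m. z i = y i) \<longrightarrow> X z n = X y n"
      by (intro exI[of _ "Suc (prod_encode (1, n))"]) (simp add: X_def)
  qed
  also have "X ` C = {x. separated F x}"
  proof (intro equalityI subsetI)
    fix x assume "x \<in> X ` C"
    then obtain y where y: "y \<in> C" "x = X y"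
      by blast
    have "range (c y) \<subseteq> {..N y}"
      using y(1) by (auto simp: C_def)
    then have "finite (range (c y))"
      by (rule finite_subset) simp
    moreover have "far F {i. c y i = k \<and> x i} {j. c y j = l \<and> \<not> x j}" for k l
    proof -
      have "e (t y k l) \<in> F"
        using e by blast
      moreover have "1 / Suc (N y) \<le> e (t y k l) i j"
        if "i \<in> {i. c y i = k \<and> x i}" "j \<in> {j. c y j = l \<and> \<not> x j}" for i j
        using y that by (auto simp: C_def)
      moreover have "1 / real (Suc (N y)) > 0"
        by simp
      ultimately show ?thesis
        unfolding far_def by blast
    qed
    ultimately show "x \<in> {x. separated F x}"
      unfolding separated_def by blast
  next
    fix x assume "x \<in> {x. separated F x}"
    then obtain a :: "nat \<Rightarrow> nat" where a: "finite (range a)"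
      and far: "\<And>k l. far F {i. a i = k \<and> x i} {j. a j = l \<and> \<not> x j}"
      unfolding separated_def by blast
    have "\<exists>s n. \<forall>i j. a i = k \<longrightarrow> x i \<longrightarrow> a j = l \<longrightarrow> \<not> x j \<longrightarrow> 1 / Suc n \<le> e s i j" for k l
    proof -
      obtain d \<delta> where d: "d \<in> F" "\<delta> > 0"
        "\<forall>i\<in>{i. a i = k \<and> x i}. \<forall>j\<in>{j. a j = l \<and> \<not> x j}. \<delta> \<le> d i j"
        using far[of k l] unfolding far_def by blast
      obtain s where s: "d = e s"
        using d(1) e by blast
      obtain n where n: "1 / Suc n < \<delta>"
        using nat_approx_posE[OF d(2)] by metis
      have "1 / Suc n \<le> e s i j" if "a i = k" "x i" "a j = l" "\<not> x j" for i j
        using d(3) that n s by fastforce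
      then show ?thesis
        by blast
    qed
    then have "\<exists>s n. \<forall>k l i j. a i = k \<longrightarrow> x i \<longrightarrow> a j = l \<longrightarrow> \<not> x j \<longrightarrow> 1 / Suc (n k l) \<le> e (s k l) i j"
      by metis
    then obtain s n where sn: "\<And>i j. x i \<Longrightarrow> \<not> x j \<Longrightarrow> 1 / Suc (n (a i) (a j)) \<le> e (s (a i) (a j)) i j"
      by blast
    \<comment> \<open>A bound for all used colours and for the numbers \<open>n k l\<close> at such
      colours, so that it can serve as the single entry \<open>N\<close>.\<close>
    define b where "b = Max (range a \<union> (\<lambda>(k, l). n k l) ` (range a \<times> range a))"
    have fin: "finite (range a \<union> (\<lambda>(k, l). n k l) ` (range a \<times> range a))"
      using a by simp
    have ab: "a i \<le> b" and nb: "n (a i) (a j) \<le> b" for i j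
      unfolding b_def using fin by (auto intro!: Max_ge)
    define y where "y p = (let (u, i) = prod_decode p in
      if u = 0 then b else if u = 1 then of_bool (x i) else if u = 2 then a i
      else case_prod s (prod_decode i))" for p
    have y: "N y = b" "X y = x" "c y = a" "t y = s"
      by (auto simp: y_def N_def X_def c_def t_def fun_eq_iff)
    have "1 / Suc b \<le> e (s (a i) (a j)) i j" if "x i" "\<not> x j" for i j
    proof -
      have "1 / Suc b \<le> 1 / Suc (n (a i) (a j))"
        using nb[of i j] by (simp add: frac_le)
      then show ?thesis
        using sn[OF that] by linarith
    qed
    then have "y \<in> C"
      using ab by (simp add: C_def y)
    then show "x \<in> X ` C"
      using y(2) by blast
  qed
  finally show ?thesis .
qed

section \<open>The subgroups attached to finite sets of metrics\<close>

definition smirnov_subgroup :: "(nat \<Rightarrow> nat \<Rightarrow> real) set \<Rightarrow> (nat \<Rightarrow> bool) set" where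
  "smirnov_subgroup D = {x. (\<lambda>n. of_bool (x n)) \<in> smirnov_ring D}"

lemma group_cantor_group: "group cantor_group"
  by (rule groupI) (auto simp: cantor_group_def fun_eq_iff)

lemma inv_cantor_group: "inv\<^bsub>cantor_group\<^esub> x = x"
  by (rule group.inv_equality[OF group_cantor_group]) (simp_all add: cantor_group_def)

lemma subgroup_smirnov_subgroup: "subgroup (smirnov_subgroup D) cantor_group"
proof
  interpret regular_subring "smirnov_ring D"
    by (rule regular_subring_smirnov_ring)
  show "smirnov_subgroup D \<subseteq> carrier cantor_group"
    by (simp add: cantor_group_def)
  show "\<one>\<^bsub>cantor_group\<^esub> \<in> smirnov_subgroup D"
    using const[of 0] by (simp add: cantor_group_def smirnov_subgroup_def)
  fix x assume x: "x \<in> smirnov_subgroup D"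
  then show "inv\<^bsub>cantor_group\<^esub> x \<in> smirnov_subgroup D"
    by (simp add: inv_cantor_group)
  fix y assume y: "y \<in> smirnov_subgroup D"
  have xy: "(\<lambda>n. of_bool (x n)) \<in> smirnov_ring D" "(\<lambda>n. of_bool (y n)) \<in> smirnov_ring D"
    using x y by (simp_all add: smirnov_subgroup_def)
  have "(\<lambda>n. (of_bool (x n) + of_bool (y n)) - 2 * (of_bool (x n) * of_bool (y n))) \<in> smirnov_ring D"
    by (intro diff add mult const xy)
  also have "(\<lambda>n. (of_bool (x n) + of_bool (y n)) - 2 * (of_bool (x n) * of_bool (y n))) = (\<lambda>n. of_bool (x n \<noteq> y n) :: real)"
    by (auto simp: fun_eq_iff of_bool_def)
  finally show "x \<otimes>\<^bsub>cantor_group\<^esub> y \<in> smirnov_subgroup D"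
    by (simp add: cantor_group_def smirnov_subgroup_def)
qed

text \<open>A finite modification adds a finite combination of indicators of singletons, which lie
  in every regular subring.\<close>

lemma closed_fin_mod_smirnov_subgroup: "closed_fin_mod (smirnov_subgroup D)"
proof -
  interpret regular_subring "smirnov_ring D"
    by (rule regular_subring_smirnov_ring)
  have imp: "y \<in> smirnov_subgroup D" if fin: "finite {n. x n \<noteq> y n}" and x: "x \<in> smirnov_subgroup D" for x y
  proof -
    let ?S = "{n. x n \<noteq> y n}"
    have "(\<lambda>n. of_bool (x n) + (\<Sum>k\<in>?S. (of_bool (y k) - of_bool (x k)) * indicator {k} n)) \<in> smirnov_ring D"
      using x unfolding smirnov_subgroup_def mem_Collect_eq
      by (intro add sum fin mult const indicator_singleton)
    also have "(\<lambda>n. of_bool (x n) + (\<Sum>k\<in>?S. (of_bool (y k) - of_bool (x k)) * indicator {k} n)) = (\<lambda>n. of_bool (y n) :: real)"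
    proof
      fix n
      have "(\<Sum>k\<in>?S. (of_bool (y k) - of_bool (x k)) * indicator {k} n) =
          (\<Sum>k\<in>?S. if k = n then of_bool (y n) - of_bool (x n) else (0 :: real))"
        by (rule sum.cong) (auto simp: indicator_def)
      also have "\<dots> = of_bool (y n) - of_bool (x n)"
        using fin by simp
      finally show "of_bool (x n) + (\<Sum>k\<in>?S. (of_bool (y k) - of_bool (x k)) * indicator {k} n) = (of_bool (y n) :: real)"
        by simp
    qed
    finally show ?thesis
      by (simp add: smirnov_subgroup_def)
  qed
  show ?thesis
    unfolding closed_fin_mod_def
  proof (intro allI impI)
    fix x y :: "nat \<Rightarrow> bool" assume fin: "finite {n. x n \<noteq> y n}"
    moreover have "{n. y n \<noteq> x n} = {n. x n \<noteq> y n}"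
      by auto
    ultimately show "x \<in> smirnov_subgroup D \<longleftrightarrow> y \<in> smirnov_subgroup D"
      using imp[of x y] imp[of y x] by auto
  qed
qed

text \<open>A bounded function rounded down to multiples of \<epsilon> is a finite linear
  combination of 0-1 sequences and stays within \<epsilon> of the original.\<close>

lemma smirnov_ring_if_smirnov_subgroup_UNIV:
  assumes "smirnov_subgroup D = UNIV"
  shows "smirnov_ring D = {f. bounded (range f)}"
proof (intro equalityI subsetI)
  interpret regular_subring "smirnov_ring D"
    by (rule regular_subring_smirnov_ring)
  show "f \<in> {f. bounded (range f)}" if "f \<in> smirnov_ring D" for f
    using bounded[OF that] by simp
  fix f :: "nat \<Rightarrow> real" assume "f \<in> {f. bounded (range f)}"
  then obtain B where B: "\<And>i. \<bar>f i\<bar> \<le> B"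
    by (auto simp: bounded_iff)
  show "f \<in> smirnov_ring D"
  proof (rule uniform_limit)
    fix \<epsilon> :: real assume "\<epsilon> > 0"
    define m where "m i = \<lfloor>f i / \<epsilon>\<rfloor>" for i
    have "m i \<in> {\<lfloor>- B / \<epsilon>\<rfloor>..\<lfloor>B / \<epsilon>\<rfloor>}" for i
      unfolding m_def atLeastAtMost_iff using B[of i] \<open>\<epsilon> > 0\<close>
      by (intro conjI floor_mono divide_right_mono) auto
    then have fin: "finite (range m)"
      by (meson finite_atLeastAtMost_int finite_subset image_subsetI)
    have level: "(\<lambda>n. of_bool (m n = k)) \<in> smirnov_ring D" for k
      using assms by (auto simp: smirnov_subgroup_def)
    have "(\<lambda>n. \<Sum>k\<in>range m. (\<epsilon> * of_int k) * of_bool (m n = k)) \<in> smirnov_ring D"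
      by (intro sum fin mult const level)
    moreover have "(\<Sum>k\<in>range m. (\<epsilon> * of_int k) * of_bool (m n = k)) = \<epsilon> * of_int (m n)" for n
    proof -
      have "(\<Sum>k\<in>range m. (\<epsilon> * of_int k) * of_bool (m n = k)) =
          (\<Sum>k\<in>range m. if k = m n then \<epsilon> * of_int (m n) else 0)"
        by (rule sum.cong) auto
      then show ?thesis
        using fin by simp
    qed
    moreover have "\<bar>f n - \<epsilon> * of_int (m n)\<bar> \<le> \<epsilon>" for n
    proof -
      have "of_int (m n) * \<epsilon> \<le> f n" "f n < (of_int (m n) + 1) * \<epsilon>"
        unfolding m_def using \<open>\<epsilon> > 0\<close> floor_divide_lower floor_divide_upper by auto
      then show ?thesis
        by (simp add: algebra_simps)
    qed
    ultimately show "\<exists>g\<in>smirnov_ring D. \<forall>n. \<bar>f n - g n\<bar> \<le> \<epsilon>"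
      by (metis (no_types, lifting))
  qed
qed

lemma smirnov_subgroup_eq_separated:
  assumes "D \<subseteq> M_omega" "D \<noteq> {}"
  shows "smirnov_subgroup D = {x. separated D x}"
  using separated_if_smirnov_ring[OF assms] smirnov_ring_if_separated[OF assms(1)]
  by (auto simp: smirnov_subgroup_def)

lemma smirnov_subgroup_in_A_family:
  assumes "F \<subseteq> M_omega" "finite F" "F \<noteq> {}" "\<not> beta_omega \<simeq> cpt_sup (smirnov ` F)"
  shows "smirnov_subgroup F \<in> A_family"
proof -
  have "analytic (smirnov_subgroup F)"
    using smirnov_subgroup_eq_separated[OF assms(1,3)] analytic_separated[OF assms(2,3)] by simp
  moreover have "smirnov_subgroup F \<noteq> UNIV"
    using smirnov_ring_if_smirnov_subgroup_UNIV beta_omega_equiv_sup_iff[OF assms(1)] assms(4) by blast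
  ultimately show ?thesis
    by (simp add: A_family_def subgroup_smirnov_subgroup closed_fin_mod_smirnov_subgroup)
qed

section \<open>Comparison of the cardinals\<close>

text \<open>Cardinals are well-ordered, so the choice in \<open>least_card\<close> has a
  witness.\<close>

lemma least_card_attained:
  assumes "\<S> \<noteq> {}"
  obtains X where "X \<in> \<S>" "least_card \<S> = Some |X|" "\<forall>Y\<in>\<S>. |X| \<le>o |Y|"
proof -
  obtain r where "r \<in> card_of ` \<S>" "\<forall>s\<in>card_of ` \<S>. r \<le>o s"
    using exists_minim_Card_order[of "card_of ` \<S>"] assms by auto
  then have "\<exists>\<kappa>. \<exists>X\<in>\<S>. \<kappa> = |X| \<and> (\<forall>Y\<in>\<S>. |X| \<le>o |Y| )"
    by blast
  from someI_ex[OF this] show ?thesis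
    using that assms unfolding least_card_def by auto
qed

theorem theorem3p6:
  shows "cov_A \<le>\<^sub>c sp"
proof (cases "{D. D \<subseteq> M'_omega \<and> smirnov_FIP D \<and> beta_omega \<simeq> cpt_sup (smirnov ` D)} = {}")
  case True
  \<comment> \<open>With no set of the required kind, \<open>sp\<close> is \<infinity>.\<close>
  then have "sp = None"
    by (simp add: sp_def least_card_def)
  then show ?thesis
    by simp
next
  case False
  obtain D where "D \<in> {D. D \<subseteq> M'_omega \<and> smirnov_FIP D \<and> beta_omega \<simeq> cpt_sup (smirnov ` D)}"
    and sp: "sp = Some |D|"
    by (rule least_card_attained[OF False, folded sp_def])
  then have D: "D \<subseteq> M'_omega" "smirnov_FIP D" "beta_omega \<simeq> cpt_sup (smirnov ` D)"
    by simp_all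
  have M: "D \<subseteq> M_omega"
    using D(1) by (auto simp: M'_omega_def)
  \<comment> \<open>A finite \<open>D\<close> would contradict its own Smirnov-FIP.\<close>
  have "infinite D"
    using D(2,3) by (auto simp: smirnov_FIP_def)
  then have "D \<noteq> {}"
    by auto
  \<comment> \<open>The empty set is left out, since analyticity was obtained for nonempty
    \<open>F\<close>.\<close>
  define \<A> where "\<A> = smirnov_subgroup ` (Fpow D - {{}})"
  have "\<A> \<subseteq> A_family"
  proof
    fix H assume "H \<in> \<A>"
    then obtain F where "H = smirnov_subgroup F" "F \<subseteq> D" "finite F" "F \<noteq> {}"
      by (auto simp: \<A>_def Fpow_def)
    then show "H \<in> A_family"
      using smirnov_subgroup_in_A_family[of F] M D(2) by (auto simp: smirnov_FIP_def)
  qed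
  moreover have "\<Union>\<A> = UNIV"
  proof -
    \<comment> \<open>A colouring that separates \<open>x\<close> with respect to \<open>D\<close>
      calls for only finitely many metrics.\<close>
    have "x \<in> \<Union>\<A>" for x
    proof -
      have "bounded (range (\<lambda>n. of_bool (x n) :: real))"
        by (auto simp: bounded_iff intro!: exI[of _ 1])
      then have "(\<lambda>n. of_bool (x n)) \<in> smirnov_ring D"
        using D(3) beta_omega_equiv_sup_iff[OF M] by auto
      then obtain F where F: "F \<subseteq> D" "finite F" "F \<noteq> {}" "separated F x"
        using separated_if_smirnov_ring[OF M \<open>D \<noteq> {}\<close>] separated_finite_subset by metis
      then have "x \<in> smirnov_subgroup F"
        using smirnov_subgroup_eq_separated[of F] M by auto
      then show ?thesis
        using F by (auto simp: \<A>_def Fpow_def)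
    qed
    then show ?thesis
      by blast
  qed
  ultimately have \<A>: "\<A> \<in> {\<A>. \<A> \<subseteq> A_family \<and> \<Union>\<A> = UNIV}"
    by blast
  then have nonempty: "{\<A>. \<A> \<subseteq> A_family \<and> \<Union>\<A> = UNIV} \<noteq> {}"
    by (metis empty_iff)
  obtain X where "X \<in> {\<A>. \<A> \<subseteq> A_family \<and> \<Union>\<A> = UNIV}" and X: "cov_A = Some |X|"
    and least: "\<forall>\<B>\<in>{\<A>. \<A> \<subseteq> A_family \<and> \<Union>\<A> = UNIV}. |X| \<le>o |\<B>|"
    by (rule least_card_attained[OF nonempty, folded cov_A_def])
  \<comment> \<open>An infinite \<open>D\<close> has as many finite subsets as elements, so the
    cover has at most \<open>|D|\<close> members.\<close>
  note bspec[OF least \<A>]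
  also have "|\<A>| \<le>o |Fpow D - {{}}|"
    unfolding \<A>_def by (rule card_of_image)
  also have "|Fpow D - {{}}| \<le>o |Fpow D|"
    by (rule card_of_mono1) auto
  also have "|Fpow D| =o |D|"
    using \<open>infinite D\<close> by (rule card_of_Fpow_infinite)
  finally show ?thesis
    by (simp add: X sp)
qed

end
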